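(* Let $\Omega$ be a Polish space and let $(S(t))_{t\ge0}$ be a $\tau^\circ$-bi-continuous semigroup on the space $\mathrm{M}(\Omega)$ of bounded Baire measures, where $\tau^\circ=\sigma(\mathrm{M}(\Omega),\mathrm{C}_{\mathrm{b}}(\Omega))$. Then there is a $\tau_{\mathrm{c}}$-bi-continuous semigroup $(T(t))_{t\ge0}$ on $\mathrm{C}_{\mathrm{b}}(\Omega)$ with $T^\circ(t)=S(t)$ for all $t\ge0$, where $T^\circ(t):=T(t)'|_{\mathrm{M}(\Omega)}$.
   Context: $\mathrm{C}_{\mathrm{b}}(\Omega)$ is the Banach space of bounded continuous functions $f:\Omega\to\mathbb{R}$ with the sup-norm. $\tau_{\mathrm{c}}$ is the compact-open topology on $\mathrm{C}_{\mathrm{b}}(\Omega)$, generated by the seminorms $p_K(f)=\sup_{x\in K}|f(x)|$, $K\subseteq\Omega$ compact. $\mathrm{M}(\Omega)$ is the Banach space of bounded (signed) Baire measures on $\Omega$ with the total variation norm, identified with a closed subspace of the norm dual $\mathrm{C}_{\mathrm{b}}(\Omega)'$ via $\mu\mapsto\big(f\mapsto\int_\Omega f\,d\mu\big)$; $\tau^\circ=\sigma(\mathrm{M}(\Omega),\mathrm{C}_{\mathrm{b}}(\Omega))$ is the weak topology on $\mathrm{M}(\Omega)$ induced by this duality. $T(t)'$ is the Banach space adjoint of $T(t)$ on $\mathrm{C}_{\mathrm{b}}(\Omega)'$; when $T(t)$ is $\tau_{\mathrm{c}}$-sequentially continuous on norm-bounded sets, $T(t)'$ leaves $\mathrm{M}(\Omega)$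 invariant. Let $X$ be a Banach space with an additional locally convex topology $\tau$ such that: (i) $\tau$ is Hausdorff and coarser than the norm topology; (ii) $(X,\tau)$ is sequentially complete on $\tau$-closed, norm-bounded sets; (iii) $\|x\|=\sup\{|\varphi(x)|:\varphi\in(X,\tau)',\|\varphi\|\le1\}$ for all $x\in X$. A (one-parameter) semigroup $(T(t))_{t\ge0}$ of bounded linear operators on $X$ ($T(0)=I$, $T(t+s)=T(t)T(s)$) is $\tau$-bi-continuous if: (a) for every $x\in X$ the orbit $t\mapsto T(t)x$ is $\tau$-continuous on $[0,\infty)$; (b) $t\mapsto T(t)$ is norm-bounded on $[0,1]$ (hence exponentially bounded); (c) for every norm-bounded sequence $(x_n)$ with $x_n\to0$ in $\tau$, $T(t)x_n\to0$ in $\tau$ uniformly for $t$ in compact subintervals of $[0,\infty)$. This is applied to $(\mathrm{C}_{\mathrm{b}}(\Omega),\tau_{\mathrm{c}})$ and to $(\mathrm{M}(\Omega),\tau^\circ)$, both of which satisfy (i)--(iii) for Polish $\Omega$. *)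

theory Defs
  imports "HOL-Analysis.Analysis"
begin

section \<open>Bounded signed Baire measures\<close>

(* The smallest sigma-algebra for which all continuous real-valued functions are measurable. *)
definition baire :: "'a::topological_space measure" where
  "baire = sigma UNIV {f -` B | (f :: 'a \<Rightarrow> real) B. continuous_on UNIV f \<and> B \<in> sets borel}"

lemma space_baire [simp]: "space (baire :: 'a::topological_space measure) = UNIV"
  by (simp add: baire_def)

lemma sets_baire:
  "sets (baire :: 'a::topological_space measure) =
     sigma_sets UNIV {f -` B | (f :: 'a \<Rightarrow> real) B. continuous_on UNIV f \<and> B \<in> sets borel}"
  by (simp add: baire_def)

lemma UNIV_in_baire [simp]: "UNIV \<in> sets (baire :: 'a::topological_space measure)"
  using sets.top[of "baire :: 'a measure"] by simp

lemma Compl_in_baire [simp]: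
  fixes A :: "'a::topological_space set"
  assumes "A \<in> sets baire" shows "- A \<in> sets baire"
  using sets.compl_sets[OF assms] by (simp add: Compl_eq_Diff_UNIV)

lemma continuous_measurable_baire:
  fixes f :: "'a::topological_space \<Rightarrow> real"
  assumes "continuous_on UNIV f"
  shows "f \<in> borel_measurable baire"
  by (rule measurableI) (use assms in \<open>auto simp: sets_baire intro!: sigma_sets.Basic\<close>)

lemma sets_baire_eq_borel:
  "sets (baire :: 'a::metric_space measure) = sets borel"
proof (rule antisym)
  show "sets (baire :: 'a measure) \<subseteq> sets borel"
    unfolding sets_baire
  proof (rule sets.sigma_sets_subset[of _ borel, simplified], safe)
    fix f :: "'a \<Rightarrow> real" and B :: "real set"
    assume "continuous_on UNIV f" "B \<in> sets borel"
    then show "f -` B \<in> sets borel"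
      using measurable_sets[of f borel borel B] borel_measurable_continuous_onI[of f] by simp
  qed
next
  have closed: "S \<in> sets (baire :: 'a measure)" if "closed S" for S :: "'a set"
  proof (cases "S = {}")
    case False
    have "S = (\<lambda>x. infdist x S) -` {0}"
      using in_closed_iff_infdist_zero[OF that False] by auto
    moreover have "continuous_on UNIV (\<lambda>x. infdist x S)"
      by (intro continuous_intros)
    ultimately show ?thesis
      unfolding sets_baire by (blast intro: sigma_sets.Basic borel_singleton sets.empty_sets)
  qed simp
  show "sets borel \<subseteq> sets (baire :: 'a measure)"
    unfolding borel_eq_closed using closed
    by (subst sets_measure_of) (auto intro!: sets.sigma_sets_subset[of _ baire, simplified])
qed

(* Sets outside the Baire sigma-algebra get the dummy value 0, so that equality of set functions
   is equality of measures. *)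
typedef (overloaded) 'a baire_measure =
  "{\<mu> :: 'a::topological_space set \<Rightarrow> real.
      (\<forall>A. A \<notin> sets baire \<longrightarrow> \<mu> A = 0) \<and>
      (\<forall>A :: nat \<Rightarrow> 'a set. range A \<subseteq> sets baire \<and> disjoint_family A \<longrightarrow>
          (\<lambda>i. \<mu> (A i)) sums \<mu> (\<Union>i. A i)) \<and>
      bounded (range \<mu>)}"
  morphisms bval Abs_baire_measure
  by (rule exI[of _ "\<lambda>_. 0"]) auto

setup_lifting type_definition_baire_measure

lemma bval_outside: "A \<notin> sets baire \<Longrightarrow> bval \<mu> A = 0"
  using bval[of \<mu>] by auto

lemma bval_sums:
  "range A \<subseteq> sets baire \<Longrightarrow> disjoint_family A \<Longrightarrow> (\<lambda>i. bval \<mu> (A i)) sums bval \<mu> (\<Union>i. A i)"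
  for A :: "nat \<Rightarrow> 'a::topological_space set"
  using bval[of \<mu>] by auto

lemma bval_bounded: obtains C where "C \<ge> 0" "\<And>A. \<bar>bval \<mu> A\<bar> \<le> C"
proof -
  have "bounded (range (bval \<mu>))" using bval[of \<mu>] by auto
  then obtain C where "\<forall>x\<in>range (bval \<mu>). norm x \<le> C" unfolding bounded_iff by blast
  then have C: "\<And>A. \<bar>bval \<mu> A\<bar> \<le> C" by auto
  moreover have "C \<ge> 0" using C[of undefined] by linarith
  ultimately show ?thesis using that by blast
qed

lemma bval_empty [simp]: "bval \<mu> {} = 0"
proof -
  have "(\<lambda>i::nat. bval \<mu> {}) sums bval \<mu> (\<Union>i::nat. {})"
    by (rule bval_sums) (auto simp: disjoint_family_on_def)
  then have "summable (\<lambda>i::nat. bval \<mu> {})" by (rule sums_summable)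
  then show ?thesis by (simp add: summable_const_iff)
qed

lemma bval_Un:
  assumes "A \<in> sets baire" "B \<in> sets baire" "A \<inter> B = {}"
  shows "bval \<mu> (A \<union> B) = bval \<mu> A + bval \<mu> B"
proof -
  have "(\<lambda>i. bval \<mu> (binaryset A B i)) sums bval \<mu> (\<Union>i. binaryset A B i)"
    by (rule bval_sums)
      (use assms in \<open>auto simp: disjoint_family_on_def binaryset_def range_binaryset_eq\<close>)
  moreover have "(\<lambda>i. bval \<mu> (binaryset A B i)) sums (bval \<mu> A + bval \<mu> B)"
    by (rule binaryset_sums) simp
  ultimately show ?thesis by (simp add: UN_binaryset_eq sums_unique2)
qed

lemma bval_Union:
  assumes "finite P" "P \<subseteq> sets baire" "disjoint P"
  shows "bval \<mu> (\<Union>P) = (\<Sum>A\<in>P. bval \<mu> A)"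
  using assms
proof (induction P rule: finite_induct)
  case (insert A P)
  have "\<Union>P \<in> sets baire" using insert by (intro sets.finite_Union) auto
  moreover have "A \<inter> \<Union>P = {}"
    using insert.hyps insert.prems by (auto simp: disjoint_def)
  ultimately show ?case
    using insert by (simp add: bval_Un pairwise_insert)
qed simp

instantiation baire_measure :: (topological_space) real_vector
begin

lift_definition zero_baire_measure :: "'a baire_measure" is "\<lambda>_. 0" by auto

lift_definition plus_baire_measure :: "'a baire_measure \<Rightarrow> 'a baire_measure \<Rightarrow> 'a baire_measure"
  is "\<lambda>\<mu> \<nu> A. \<mu> A + \<nu> A"
  by (auto intro!: sums_add bounded_plus_comp)

lift_definition minus_baire_measure :: "'a baire_measure \<Rightarrow> 'a baire_measure \<Rightarrow> 'a baire_measure"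
  is "\<lambda>\<mu> \<nu> A. \<mu> A - \<nu> A"
  by (auto intro!: sums_diff bounded_minus_comp)

lift_definition uminus_baire_measure :: "'a baire_measure \<Rightarrow> 'a baire_measure"
  is "\<lambda>\<mu> A. - \<mu> A"
  by (auto intro!: sums_minus)

lift_definition scaleR_baire_measure :: "real \<Rightarrow> 'a baire_measure \<Rightarrow> 'a baire_measure"
  is "\<lambda>c \<mu> A. c * \<mu> A"
  by (auto intro!: sums_mult bounded_scaleR_comp[where 'b=real, simplified])

instance
  by standard (transfer; auto simp: algebra_simps)+

end

lemma bval_simps [simp]:
  "bval 0 A = 0" "bval (\<mu> + \<nu>) A = bval \<mu> A + bval \<nu> A" "bval (\<mu> - \<nu>) A = bval \<mu> A - bval \<nu> A"
  "bval (- \<mu>) A = - bval \<mu> A" "bval (c *\<^sub>R \<mu>) A = c * bval \<mu> A"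
  by (transfer; simp)+

definition baire_partitions :: "'a::topological_space set set set" where
  "baire_partitions = {P. finite P \<and> P \<subseteq> sets baire \<and> partition_on UNIV P}"

lemma UNIV_baire_partition: "{UNIV} \<in> baire_partitions"
  by (auto simp: baire_partitions_def partition_on_def)

lemma baire_partitions_nonempty: "baire_partitions \<noteq> {}"
  using UNIV_baire_partition by blast

lemma bdd_above_variation:
  "bdd_above ((\<lambda>P. \<Sum>A\<in>P. \<bar>bval \<mu> A\<bar>) ` baire_partitions)"
proof -
  obtain C where C: "C \<ge> 0" "\<And>A. \<bar>bval \<mu> A\<bar> \<le> C" using bval_bounded[of \<mu>] by blast
  have "(\<Sum>A\<in>P. \<bar>bval \<mu> A\<bar>) \<le> 2 * C" if "P \<in> baire_partitions" for P
  proof -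
    have P: "finite P" "P \<subseteq> sets baire" "disjoint P"
      using that by (auto simp: baire_partitions_def partition_on_def)
    let ?P = "{A\<in>P. bval \<mu> A \<ge> 0}" and ?N = "{A\<in>P. \<not> bval \<mu> A \<ge> 0}"
    have "(\<Sum>A\<in>P. \<bar>bval \<mu> A\<bar>) = (\<Sum>A\<in>?P. \<bar>bval \<mu> A\<bar>) + (\<Sum>A\<in>?N. \<bar>bval \<mu> A\<bar>)"
      using P(1) by (subst sum.union_disjoint[symmetric]) (auto intro: sum.cong)
    also have "(\<Sum>A\<in>?P. \<bar>bval \<mu> A\<bar>) = bval \<mu> (\<Union>?P)"
      using P by (subst bval_Union) (auto simp: disjoint_def intro!: sum.cong)
    also have "(\<Sum>A\<in>?N. \<bar>bval \<mu> A\<bar>) = - bval \<mu> (\<Union>?N)"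
      using P by (subst bval_Union) (auto simp: disjoint_def sum_negf[symmetric] intro!: sum.cong)
    also have "bval \<mu> (\<Union>?P) + - bval \<mu> (\<Union>?N) \<le> 2 * C"
      using C(2)[of "\<Union>?P"] C(2)[of "\<Union>?N"] by linarith
    finally show ?thesis .
  qed
  then show ?thesis by (auto intro!: bdd_aboveI)
qed

instantiation baire_measure :: (topological_space) real_normed_vector
begin

(* total variation norm *)
definition norm_baire_measure :: "'a baire_measure \<Rightarrow> real" where
  "norm \<mu> = (SUP P\<in>baire_partitions. \<Sum>A\<in>P. \<bar>bval \<mu> A\<bar>)"

definition dist_baire_measure :: "'a baire_measure \<Rightarrow> 'a baire_measure \<Rightarrow> real" where
  "dist \<mu> \<nu> = norm (\<mu> - \<nu>)" for \<mu> \<nu> :: "'a baire_measure"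

definition sgn_baire_measure :: "'a baire_measure \<Rightarrow> 'a baire_measure" where
  "sgn \<mu> = inverse (norm \<mu>) *\<^sub>R \<mu>" for \<mu> :: "'a baire_measure"

definition uniformity_baire_measure :: "('a baire_measure \<times> 'a baire_measure) filter" where
  "uniformity_baire_measure = (INF e\<in>{0 <..}. principal {(x, y). dist x y < e})"

definition open_baire_measure :: "'a baire_measure set \<Rightarrow> bool" where
  "open_baire_measure S = (\<forall>x\<in>S. \<forall>\<^sub>F (x', y) in uniformity. x' = x \<longrightarrow> y \<in> S)"

lemma variation_le_norm:
  "P \<in> baire_partitions \<Longrightarrow> (\<Sum>A\<in>P. \<bar>bval \<mu> A\<bar>) \<le> norm \<mu>" for \<mu> :: "'a baire_measure"
  unfolding norm_baire_measure_def by (rule cSUP_upper[OF _ bdd_above_variation])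

lemma norm_baire_measure_le:
  "(\<And>P. P \<in> baire_partitions \<Longrightarrow> (\<Sum>A\<in>P. \<bar>bval \<mu> A\<bar>) \<le> C) \<Longrightarrow> norm \<mu> \<le> C"
  for \<mu> :: "'a baire_measure"
  unfolding norm_baire_measure_def by (rule cSUP_least[OF baire_partitions_nonempty])

lemma norm_baire_measure_nonneg: "0 \<le> norm \<mu>" for \<mu> :: "'a baire_measure"
  using variation_le_norm[OF UNIV_baire_partition, of \<mu>] by simp

lemma abs_bval_le_norm: "\<bar>bval \<mu> A\<bar> \<le> norm \<mu>" for \<mu> :: "'a baire_measure"
proof -
  consider "A \<notin> sets baire \<or> A = {}" | "A = UNIV" | "A \<in> sets baire" "A \<noteq> {}" "A \<noteq> UNIV" by blast
  then show ?thesis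
  proof cases
    case 1
    then show ?thesis using norm_baire_measure_nonneg[of \<mu>] by (auto simp: bval_outside)
  next
    case 2
    then show ?thesis using variation_le_norm[OF UNIV_baire_partition, of \<mu>] by simp
  next
    case 3
    then have "{A, - A} \<in> baire_partitions"
      by (auto simp: baire_partitions_def partition_on_def disjoint_def)
    from variation_le_norm[OF this, of \<mu>] show ?thesis
      by (cases "A = - A") auto
  qed
qed

instance
proof
  fix \<mu> \<nu> :: "'a baire_measure" and c :: real
  show "norm \<mu> = 0 \<longleftrightarrow> \<mu> = 0"
  proof
    assume "norm \<mu> = 0"
    then have "bval \<mu> A = 0" for A using abs_bval_le_norm[of \<mu> A] by simp
    then show "\<mu> = 0" by (auto simp: bval_inject[symmetric] fun_eq_iff)
  next
    assume "\<mu> = 0"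
    then have "norm \<mu> \<le> 0" by (intro norm_baire_measure_le) simp
    then show "norm \<mu> = 0" using norm_baire_measure_nonneg[of \<mu>] by simp
  qed
  show "norm (\<mu> + \<nu>) \<le> norm \<mu> + norm \<nu>"
  proof (rule norm_baire_measure_le)
    fix P :: "'a set set" assume P: "P \<in> baire_partitions"
    have "(\<Sum>A\<in>P. \<bar>bval (\<mu> + \<nu>) A\<bar>) \<le> (\<Sum>A\<in>P. \<bar>bval \<mu> A\<bar>) + (\<Sum>A\<in>P. \<bar>bval \<nu> A\<bar>)"
      unfolding sum.distrib[symmetric] by (rule sum_mono) simp
    also have "\<dots> \<le> norm \<mu> + norm \<nu>" by (intro add_mono variation_le_norm P)
    finally show "(\<Sum>A\<in>P. \<bar>bval (\<mu> + \<nu>) A\<bar>) \<le> norm \<mu> + norm \<nu>" .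
  qed
  have le: "norm (d *\<^sub>R \<rho>) \<le> \<bar>d\<bar> * norm \<rho>" for d and \<rho> :: "'a baire_measure"
  proof (rule norm_baire_measure_le)
    fix P :: "'a set set" assume P: "P \<in> baire_partitions"
    have "(\<Sum>A\<in>P. \<bar>bval (d *\<^sub>R \<rho>) A\<bar>) = \<bar>d\<bar> * (\<Sum>A\<in>P. \<bar>bval \<rho> A\<bar>)"
      by (simp add: abs_mult sum_distrib_left)
    also have "\<dots> \<le> \<bar>d\<bar> * norm \<rho>" by (intro mult_left_mono variation_le_norm P) simp
    finally show "(\<Sum>A\<in>P. \<bar>bval (d *\<^sub>R \<rho>) A\<bar>) \<le> \<bar>d\<bar> * norm \<rho>" .
  qed
  show "norm (c *\<^sub>R \<mu>) = \<bar>c\<bar> * norm \<mu>"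
  proof (cases "c = 0")
    case True
    have "norm (0 :: 'a baire_measure) \<le> 0" by (intro norm_baire_measure_le) simp
    then show ?thesis using True norm_baire_measure_nonneg[of "0 :: 'a baire_measure"] by simp
  next
    case False
    have "norm (inverse c *\<^sub>R (c *\<^sub>R \<mu>)) \<le> \<bar>inverse c\<bar> * norm (c *\<^sub>R \<mu>)" by (rule le)
    then have "\<bar>c\<bar> * norm \<mu> \<le> norm (c *\<^sub>R \<mu>)" using False by (simp add: field_simps)
    then show ?thesis using le[of c \<mu>] by simp
  qed
qed (simp_all add: dist_baire_measure_def sgn_baire_measure_def uniformity_baire_measure_def
       open_baire_measure_def)

end

instance baire_measure :: (topological_space) banach
proof
  fix X :: "nat \<Rightarrow> 'a baire_measure"
  assume X: "Cauchy X"
  have diff: "\<bar>bval (X m) A - bval (X n) A\<bar> \<le> norm (X m - X n)" for m n A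
    using abs_bval_le_norm[of "X m - X n" A] by simp
  have "uniformly_Cauchy_on UNIV (\<lambda>n. bval (X n))"
  proof (rule uniformly_Cauchy_onI)
    fix e :: real assume "e > 0"
    then obtain M where M: "\<And>m n. m \<ge> M \<Longrightarrow> n \<ge> M \<Longrightarrow> norm (X m - X n) < e"
      using CauchyD[OF X] by blast
    then show "\<exists>M. \<forall>x\<in>UNIV. \<forall>m\<ge>M. \<forall>n\<ge>M. dist (bval (X m) x) (bval (X n) x) < e"
      unfolding dist_real_def using diff by (meson le_less_trans)
  qed
  then obtain L where L: "uniform_limit UNIV (\<lambda>n. bval (X n)) L sequentially"
    using Cauchy_uniformly_convergent unfolding uniformly_convergent_on_def by meson
  have lim: "(\<lambda>n. bval (X n) A) \<longlonglongrightarrow> L A" for A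
    by (rule tendsto_uniform_limitI[OF L UNIV_I])
  obtain C where C: "\<And>n. norm (X n) \<le> C"
    using cauchy_imp_bounded[OF X] unfolding bounded_iff by auto
  have bL: "\<bar>L A\<bar> \<le> C" for A
    using LIMSEQ_le_const2[OF tendsto_rabs[OF lim[of A]]] abs_bval_le_norm C
    by (meson order_trans)
  have sL: "(\<lambda>i. L (A i)) sums L (\<Union>i. A i)"
    if A: "range A \<subseteq> sets baire" "disjoint_family A" for A :: "nat \<Rightarrow> 'a set"
    unfolding sums_def
  proof -
    have fin: "(\<Sum>i<k. bval \<mu> (A i)) = bval \<mu> (\<Union>i<k. A i)" for k and \<mu> :: "'a baire_measure"
    proof (induction k)
      case (Suc k)
      have "A i \<inter> A k = {}" if "i < k" for i
        using A(2) that by (simp add: disjoint_family_on_def)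
      then have "bval \<mu> ((\<Union>i<k. A i) \<union> A k) = bval \<mu> (\<Union>i<k. A i) + bval \<mu> (A k)"
        using A(1) by (intro bval_Un) auto
      then show ?case using Suc by (simp add: lessThan_Suc Un_commute)
    qed simp
    have eqL: "(\<Sum>i<k. L (A i)) = L (\<Union>i<k. A i)" for k
    proof -
      have "(\<lambda>n. \<Sum>i<k. bval (X n) (A i)) \<longlonglongrightarrow> (\<Sum>i<k. L (A i))"
        by (intro tendsto_intros lim)
      then show ?thesis using lim[of "\<Union>i<k. A i"] LIMSEQ_unique by (fastforce simp: fin)
    qed
    have "(\<lambda>k. L (\<Union>i<k. A i)) \<longlonglongrightarrow> L (\<Union>i. A i)"
    proof (rule swap_uniform_limit')
      show "\<forall>\<^sub>F n in sequentially.
              ((\<lambda>k. bval (X n) (\<Union>i<k. A i)) \<longlongrightarrow> bval (X n) (\<Union>i. A i)) sequentially"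
        using bval_sums[OF A] by (simp add: sums_def fin)
      show "(\<lambda>n. bval (X n) (\<Union>i. A i)) \<longlonglongrightarrow> L (\<Union>i. A i)" by (rule lim)
      show "uniform_limit UNIV (\<lambda>n k. bval (X n) (\<Union>i<k. A i)) (\<lambda>k. L (\<Union>i<k. A i)) sequentially"
      proof (rule uniform_limitI)
        fix e :: real assume "e > 0"
        from uniform_limitD[OF L this]
        show "\<forall>\<^sub>F n in sequentially.
                \<forall>k\<in>UNIV. dist (bval (X n) (\<Union>i<k. A i)) (L (\<Union>i<k. A i)) < e"
          by (rule eventually_mono) blast
      qed
    qed auto
    then show "(\<lambda>k. \<Sum>i<k. L (A i)) \<longlonglongrightarrow> L (\<Union>i. A i)" by (simp add: eqL)
  qed
  have "L A = 0" if "A \<notin> sets baire" for A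
    using lim[of A] bval_outside[OF that] by (simp add: LIMSEQ_const_iff)
  with sL bL have "L \<in> {\<mu>. (\<forall>A. A \<notin> sets baire \<longrightarrow> \<mu> A = 0) \<and>
      (\<forall>A :: nat \<Rightarrow> 'a set. range A \<subseteq> sets baire \<and> disjoint_family A \<longrightarrow>
          (\<lambda>i. \<mu> (A i)) sums \<mu> (\<Union>i. A i)) \<and> bounded (range \<mu>)}"
    unfolding bounded_iff by auto
  then obtain \<mu> where \<mu>: "bval \<mu> = L"
    using Abs_baire_measure_inverse by blast
  have "X \<longlonglongrightarrow> \<mu>"
  proof (rule LIMSEQ_I)
    fix e :: real assume "e > 0"
    then obtain M where M: "\<And>m n. m \<ge> M \<Longrightarrow> n \<ge> M \<Longrightarrow> norm (X m - X n) < e / 2"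
      using CauchyD[OF X, of "e / 2"] by auto
    have "norm (X n - \<mu>) \<le> e / 2" if n: "n \<ge> M" for n
    proof (rule norm_baire_measure_le)
      fix P :: "'a set set" assume P: "P \<in> baire_partitions"
      have "(\<lambda>m. \<Sum>A\<in>P. \<bar>bval (X n) A - bval (X m) A\<bar>) \<longlonglongrightarrow> (\<Sum>A\<in>P. \<bar>bval (X n) A - L A\<bar>)"
        by (intro tendsto_intros lim)
      moreover have "(\<Sum>A\<in>P. \<bar>bval (X n) A - bval (X m) A\<bar>) \<le> e / 2" if "m \<ge> M" for m
        using variation_le_norm[OF P, of "X n - X m"] M[OF n that] by simp
      ultimately have "(\<Sum>A\<in>P. \<bar>bval (X n) A - L A\<bar>) \<le> e / 2"
        by (intro LIMSEQ_le_const2) auto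
      then show "(\<Sum>A\<in>P. \<bar>bval (X n - \<mu>) A\<bar>) \<le> e / 2" by (simp add: \<mu>)
    qed
    then show "\<exists>M. \<forall>n\<ge>M. norm (X n - \<mu>) < e" using \<open>e > 0\<close>
      by (intro exI[of _ M]) fastforce
  qed
  then show "convergent X" by (auto simp: convergent_def)
qed

section \<open>Integration against a bounded Baire measure\<close>

definition upper_variation :: "'a::topological_space baire_measure \<Rightarrow> 'a set \<Rightarrow> real" where
  "upper_variation \<mu> A = (SUP B\<in>{B \<in> sets baire. B \<subseteq> A}. bval \<mu> B)"

(* The positive part of the Jordan decomposition; the negative part is pos_part (- mu). *)
definition pos_part :: "'a::topological_space baire_measure \<Rightarrow> 'a measure" where
  "pos_part \<mu> = measure_of UNIV (sets baire) (\<lambda>A. ennreal (upper_variation \<mu> A))"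

definition baire_integral :: "'a::topological_space baire_measure \<Rightarrow> ('a \<Rightarrow> real) \<Rightarrow> real" where
  "baire_integral \<mu> f = integral\<^sup>L (pos_part \<mu>) f - integral\<^sup>L (pos_part (- \<mu>)) f"

lemma bdd_above_bval: "bdd_above (bval \<mu> ` S)"
proof (rule bdd_aboveI2)
  show "bval \<mu> A \<le> norm \<mu>" for A using abs_bval_le_norm[of \<mu> A] by linarith
qed

lemma upper_variation_upper: "B \<in> sets baire \<Longrightarrow> B \<subseteq> A \<Longrightarrow> bval \<mu> B \<le> upper_variation \<mu> A"
  unfolding upper_variation_def by (rule cSUP_upper[OF _ bdd_above_bval]) simp

lemma upper_variation_least:
  "(\<And>B. B \<in> sets baire \<Longrightarrow> B \<subseteq> A \<Longrightarrow> bval \<mu> B \<le> C) \<Longrightarrow> upper_variation \<mu> A \<le> C"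
  unfolding upper_variation_def by (rule cSUP_least) (use sets.empty_sets in blast)+

lemma upper_variation_nonneg: "0 \<le> upper_variation \<mu> A"
  using upper_variation_upper[of "{}" A \<mu>] by simp

lemma upper_variation_empty: "upper_variation \<mu> {} = 0"
  by (intro antisym upper_variation_nonneg upper_variation_least) auto

lemma upper_variation_mono: "A \<subseteq> A' \<Longrightarrow> upper_variation \<mu> A \<le> upper_variation \<mu> A'"
  by (intro upper_variation_least upper_variation_upper) auto

lemma jordan_decomposition:
  assumes A: "A \<in> sets baire"
  shows "bval \<mu> A = upper_variation \<mu> A - upper_variation (- \<mu>) A"
proof -
  have *: "upper_variation \<nu> A \<le> bval \<nu> A + upper_variation (- \<nu>) A" for \<nu> :: "'a baire_measure"
  proof (rule upper_variation_least)
    fix B assume B: "B \<in> sets (baire :: 'a measure)" "B \<subseteq> A"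
    have "bval \<nu> (B \<union> (A - B)) = bval \<nu> B + bval \<nu> (A - B)"
      using A B by (intro bval_Un) auto
    moreover have "B \<union> (A - B) = A" using B by blast
    moreover have "bval (- \<nu>) (A - B) \<le> upper_variation (- \<nu>) A"
      using A B by (intro upper_variation_upper) auto
    ultimately show "bval \<nu> B \<le> bval \<nu> A + upper_variation (- \<nu>) A" by simp
  qed
  show ?thesis using *[of \<mu>] *[of "- \<mu>"] by simp
qed

lemma upper_variation_Un_ge:
  assumes "A \<in> sets baire" "A' \<in> sets baire" "A \<inter> A' = {}"
  shows "upper_variation \<mu> A + upper_variation \<mu> A' \<le> upper_variation \<mu> (A \<union> A')"
proof -
  have "upper_variation \<mu> A \<le> upper_variation \<mu> (A \<union> A') - upper_variation \<mu> A'"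
  proof (rule upper_variation_least)
    fix B :: "'a set" assume B: "B \<in> sets baire" "B \<subseteq> A"
    have "upper_variation \<mu> A' \<le> upper_variation \<mu> (A \<union> A') - bval \<mu> B"
    proof (rule upper_variation_least)
      fix B' :: "'a set" assume B': "B' \<in> sets baire" "B' \<subseteq> A'"
      have "bval \<mu> B + bval \<mu> B' = bval \<mu> (B \<union> B')"
        using B B' assms by (intro bval_Un[symmetric]) auto
      also have "\<dots> \<le> upper_variation \<mu> (A \<union> A')"
        using B B' by (intro upper_variation_upper) auto
      finally show "bval \<mu> B' \<le> upper_variation \<mu> (A \<union> A') - bval \<mu> B" by simp
    qed
    then show "bval \<mu> B \<le> upper_variation \<mu> (A \<union> A') - upper_variation \<mu> A'" by simp
  qed
  then show ?thesis by simp
qed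

lemma upper_variation_sums:
  fixes A :: "nat \<Rightarrow> 'a::topological_space set"
  assumes A: "range A \<subseteq> sets baire" "disjoint_family A"
  shows "(\<lambda>i. upper_variation \<mu> (A i)) sums upper_variation \<mu> (\<Union>i. A i)"
proof -
  have fin: "(\<Sum>i<k. upper_variation \<mu> (A i)) \<le> upper_variation \<mu> (\<Union>i<k. A i)" for k
  proof (induction k)
    case (Suc k)
    have "A i \<inter> A k = {}" if "i < k" for i
      using A(2) that by (simp add: disjoint_family_on_def)
    then have "upper_variation \<mu> (\<Union>i<k. A i) + upper_variation \<mu> (A k)
        \<le> upper_variation \<mu> ((\<Union>i<k. A i) \<union> A k)"
      using A(1) by (intro upper_variation_Un_ge) auto
    then show ?case using Suc by (simp add: lessThan_Suc Un_commute)
  qed (simp add: upper_variation_nonneg)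
  have le: "(\<Sum>i<k. upper_variation \<mu> (A i)) \<le> upper_variation \<mu> (\<Union>i. A i)" for k
    by (rule order_trans[OF fin upper_variation_mono]) blast
  have summ: "summable (\<lambda>i. upper_variation \<mu> (A i))"
    by (rule summableI_nonneg_bounded[OF upper_variation_nonneg le])
  have "upper_variation \<mu> (\<Union>i. A i) \<le> (\<Sum>i. upper_variation \<mu> (A i))"
  proof (rule upper_variation_least)
    fix B :: "'a set" assume B: "B \<in> sets baire" "B \<subseteq> (\<Union>i. A i)"
    have "(\<lambda>i. bval \<mu> (B \<inter> A i)) sums bval \<mu> (\<Union>i. B \<inter> A i)"
      by (rule bval_sums) (use A B in \<open>auto simp: disjoint_family_on_def\<close>)
    moreover have "(\<Union>i. B \<inter> A i) = B" using B by blast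
    ultimately have s: "(\<lambda>i. bval \<mu> (B \<inter> A i)) sums bval \<mu> B" by simp
    show "bval \<mu> B \<le> (\<Sum>i. upper_variation \<mu> (A i))"
    proof (rule sums_le[OF _ s summable_sums[OF summ]])
      show "bval \<mu> (B \<inter> A i) \<le> upper_variation \<mu> (A i)" for i
        using A B by (intro upper_variation_upper) auto
    qed
  qed
  moreover have "(\<Sum>i. upper_variation \<mu> (A i)) \<le> upper_variation \<mu> (\<Union>i. A i)"
    by (rule suminf_le_const[OF summ le])
  ultimately have "(\<Sum>i. upper_variation \<mu> (A i)) = upper_variation \<mu> (\<Union>i. A i)" by linarith
  then show ?thesis using summable_sums[OF summ] by metis
qed

lemma space_pos_part [simp]: "space (pos_part \<mu>) = UNIV"
  unfolding pos_part_def by (rule space_measure_of) simp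

lemma sets_pos_part [simp, measurable_cong]: "sets (pos_part \<mu>) = sets baire"
  unfolding pos_part_def
  using sets.sigma_sets_eq[of "baire :: 'a measure"] by (subst sets_measure_of) auto

lemma emeasure_pos_part:
  assumes "A \<in> sets baire"
  shows "emeasure (pos_part \<mu>) A = ennreal (upper_variation \<mu> A)"
proof (rule emeasure_measure_of[OF pos_part_def])
  show "positive (sets (pos_part \<mu>)) (\<lambda>A. ennreal (upper_variation \<mu> A))"
    by (simp add: positive_def upper_variation_empty)
  show "countably_additive (sets (pos_part \<mu>)) (\<lambda>A. ennreal (upper_variation \<mu> A))"
  proof (rule countably_additiveI)
    fix A :: "nat \<Rightarrow> 'a set"
    assume "range A \<subseteq> sets (pos_part \<mu>)" "disjoint_family A"
    then show "(\<Sum>i. ennreal (upper_variation \<mu> (A i))) = ennreal (upper_variation \<mu> (\<Union>i. A i))"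
      by (intro suminf_ennreal_eq upper_variation_nonneg upper_variation_sums) simp_all
  qed
qed (use assms in simp_all)

lemma finite_measure_pos_part: "finite_measure (pos_part \<mu>)"
  by (rule finite_measureI) (simp add: emeasure_pos_part)

lemma abs_bcontfun_le_norm: "\<bar>apply_bcontfun f x\<bar> \<le> norm f" for f :: "'a::topological_space \<Rightarrow>\<^sub>C real"
  using norm_bounded[of f x] by simp

lemma integrable_pos_part:
  fixes f :: "'a::topological_space \<Rightarrow>\<^sub>C real"
  shows "integrable (pos_part \<mu>) (apply_bcontfun f)"
proof -
  interpret finite_measure "pos_part \<mu>" by (rule finite_measure_pos_part)
  have "apply_bcontfun f \<in> borel_measurable baire"
    by (rule continuous_measurable_baire) (rule continuous_on_apply_bcontfun)
  then have "apply_bcontfun f \<in> borel_measurable (pos_part \<mu>)"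
    by (simp cong: measurable_cong_sets)
  then show ?thesis
    by (intro integrable_const_bound[where B = "norm f"]) (auto simp: abs_bcontfun_le_norm)
qed

lemma bounded_linear_baire_integral:
  "bounded_linear (\<lambda>f :: 'a::topological_space \<Rightarrow>\<^sub>C real. baire_integral \<mu> (apply_bcontfun f))"
proof -
  have *: "bounded_linear (\<lambda>f :: 'a \<Rightarrow>\<^sub>C real. integral\<^sup>L (pos_part \<nu>) (apply_bcontfun f))"
    for \<nu> :: "'a baire_measure"
  proof -
    interpret finite_measure "pos_part \<nu>" by (rule finite_measure_pos_part)
    show ?thesis
    proof (rule bounded_linear_intro[where K = "measure (pos_part \<nu>) UNIV"])
      fix f :: "'a \<Rightarrow>\<^sub>C real"
      have "norm (integral\<^sup>L (pos_part \<nu>) (apply_bcontfun f)) \<le> (\<integral>x. norm f \<partial>pos_part \<nu>)"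
        by (rule order_trans[OF integral_norm_bound integral_mono])
          (auto simp: integrable_pos_part abs_bcontfun_le_norm)
      then show "norm (integral\<^sup>L (pos_part \<nu>) (apply_bcontfun f))
          \<le> norm f * measure (pos_part \<nu>) UNIV" by (simp add: mult.commute)
    qed (simp_all add: integrable_pos_part)
  qed
  show ?thesis unfolding baire_integral_def by (intro bounded_linear_sub *)
qed

instance bcontfun :: (metric_space, banach) banach ..

section \<open>Duality, adjoints and the two topologies\<close>

(* The identification of M(Omega) with a subspace of the norm dual of C_b(Omega). *)
definition measure_functional ::
    "'a::topological_space baire_measure \<Rightarrow> ('a \<Rightarrow>\<^sub>C real) \<Rightarrow>\<^sub>L real" where
  "measure_functional \<mu> = Blinfun (\<lambda>f. baire_integral \<mu> (apply_bcontfun f))"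

lemma measure_functional_apply [simp]:
  "blinfun_apply (measure_functional \<mu>) f = baire_integral \<mu> (apply_bcontfun f)"
  unfolding measure_functional_def
  by (simp add: bounded_linear_Blinfun_apply bounded_linear_baire_integral)

definition banach_adjoint ::
    "('x::real_normed_vector \<Rightarrow>\<^sub>L 'y::real_normed_vector) \<Rightarrow> ('y \<Rightarrow>\<^sub>L real) \<Rightarrow>\<^sub>L ('x \<Rightarrow>\<^sub>L real)" where
  "banach_adjoint T = Blinfun (\<lambda>\<phi>. \<phi> o\<^sub>L T)"

lemma banach_adjoint_apply [simp]: "blinfun_apply (banach_adjoint T) \<phi> = \<phi> o\<^sub>L T"
  unfolding banach_adjoint_def
  by (rule bounded_linear_Blinfun_apply[THEN fun_cong])
    (rule bounded_bilinear.bounded_linear_left[OF bounded_bilinear_blinfun_compose])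

(* The locally convex topology generated by a family of seminorms. *)
definition seminorm_topology :: "('x::real_vector \<Rightarrow> real) set \<Rightarrow> 'x topology" where
  "seminorm_topology \<P> = topology_generated_by {{x. p (x - x0) < e} | p x0 e. p \<in> \<P> \<and> e > 0}"

(* The empty compact set is left out since the supremum of the empty set of reals is unspecified;
   it would only contribute the seminorm 0. *)
definition compact_open_topology :: "('a::topological_space \<Rightarrow>\<^sub>C real) topology" where
  "compact_open_topology =
     seminorm_topology {\<lambda>f. SUP x\<in>K. \<bar>apply_bcontfun f x\<bar> | K. compact K \<and> K \<noteq> {}}"

definition weak_measure_topology :: "'a::topological_space baire_measure topology" where
  "weak_measure_topology =
     seminorm_topology {\<lambda>\<mu>. \<bar>blinfun_apply (measure_functional \<mu>) f\<bar> | f :: 'a \<Rightarrow>\<^sub>C real. True}"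

section \<open>Bi-continuous semigroups\<close>

(* Only the values T t with t >= 0 matter. *)
definition bi_continuous_semigroup ::
    "'x::banach topology \<Rightarrow> (real \<Rightarrow> 'x \<Rightarrow>\<^sub>L 'x) \<Rightarrow> bool" where
  "bi_continuous_semigroup \<tau> T \<longleftrightarrow>
     T 0 = id_blinfun \<and>
     (\<forall>t\<ge>0. \<forall>s\<ge>0. T (t + s) = T t o\<^sub>L T s) \<and>
     (\<forall>x. continuous_map (top_of_set {0..}) \<tau> (\<lambda>t. T t x)) \<and>
     bounded (T ` {0..1}) \<and>
     (\<forall>x :: nat \<Rightarrow> 'x. bounded (range x) \<and> limitin \<tau> x 0 sequentially \<longrightarrow>
        (\<forall>a b. 0 \<le> a \<and> a \<le> b \<longrightarrow>
          (\<forall>U. openin \<tau> U \<and> 0 \<in> U \<longrightarrow>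
            (\<forall>\<^sub>F n in sequentially. \<forall>t\<in>{a..b}. T t (x n) \<in> U))))"

end

(* Set T(t) f (x) = <S(t) delta_x, f>. Weak sequential continuity of S(t) on bounded sets makes
   T(t) f continuous, and since every measure is the weak limit of a bounded sequence of finite
   combinations of Dirac measures, T(t) is the preadjoint of S(t). Joint sequential continuity of
   (t, x) |-> S(t) delta_x gives tau_c-continuous orbits. For the equicontinuity of T, a failure would
   yield measures nu_n = S(t_n) delta_{x_n} - S(t) delta_x tending weakly to 0 and a bounded sequence
   f_n tending to 0 uniformly on compact sets with <nu_n, f_n> not tending to 0. Instead of the uniform
   tightness of weakly convergent sequences of measures, a gliding hump argument excludes this: uniform
   convergence on compact sets is locally uniform convergence along the sequence, so after truncation
   the supports of the f_n are locally finite, and the f_n can be superposed with arbitrary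
   coefficients. *)
theory Submission
  imports Defs
begin

section \<open>Integrals against signed Baire measures\<close>

text \<open>Measurability of the identity of a separable metric space gives these simple functions.
  Through them an integral becomes a limit of finite sums in which the measure enters linearly. In a
  metric space Baire and Borel sets agree.\<close>

lemma baire_simple_approx_ident:
  obtains F :: "nat \<Rightarrow> 'a::polish_space \<Rightarrow> 'a"
  where "\<And>n. finite (range (F n))" "\<And>n y. F n -` {y} \<in> sets baire" "\<And>x. (\<lambda>n. F n x) \<longlonglongrightarrow> x"
proof -
  have "(\<lambda>x. x) \<in> borel_measurable (borel :: 'a measure)" by simp
  from borel_measurable_implies_sequence_metric[OF this, of undefined]
  obtain F :: "nat \<Rightarrow> 'a \<Rightarrow> 'a" where F: "\<And>n. simple_function borel (F n)" "\<And>x. (\<lambda>n. F n x) \<longlonglongrightarrow> x"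
    by auto
  show ?thesis
  proof
    show "finite (range (F n))" for n using F(1)[of n] by (simp add: simple_function_def)
    show "F n -` {y} \<in> sets baire" for n y
      using simple_functionD(2)[OF F(1), of n "{y}"] by (simp add: sets_baire_eq_borel)
  qed (rule F(2))
qed

lemma baire_integral_dominated_convergence:
  fixes f :: "nat \<Rightarrow> 'a::topological_space \<Rightarrow> real"
  assumes "\<And>n. f n \<in> borel_measurable baire" "g \<in> borel_measurable baire"
    and "\<And>n x. \<bar>f n x\<bar> \<le> B" "\<And>x. (\<lambda>n. f n x) \<longlonglongrightarrow> g x"
  shows "(\<lambda>n. baire_integral \<mu> (f n)) \<longlonglongrightarrow> baire_integral \<mu> g"
proof -
  have "(\<lambda>n. integral\<^sup>L (pos_part \<nu>) (f n)) \<longlonglongrightarrow> integral\<^sup>L (pos_part \<nu>) g" for \<nu> :: "'a baire_measure"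
  proof -
    interpret finite_measure "pos_part \<nu>" by (rule finite_measure_pos_part)
    show ?thesis
      by (rule integral_dominated_convergence[where w = "\<lambda>_. B"])
        (use assms in \<open>auto cong: measurable_cong_sets\<close>)
  qed
  then show ?thesis unfolding baire_integral_def by (intro tendsto_diff)
qed

lemma baire_integral_bcontfun_convergence:
  assumes "\<And>n. norm (f n) \<le> B" "\<And>x. (\<lambda>n. apply_bcontfun (f n) x) \<longlonglongrightarrow> apply_bcontfun g x"
  shows "(\<lambda>n. baire_integral \<mu> (apply_bcontfun (f n))) \<longlonglongrightarrow> baire_integral \<mu> (apply_bcontfun g)"
proof (rule baire_integral_dominated_convergence[where B = B])
  show "\<bar>apply_bcontfun (f n) x\<bar> \<le> B" for n x
    by (rule order_trans[OF abs_bcontfun_le_norm assms(1)])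
qed (simp_all add: continuous_measurable_baire assms(2))

lemma sum_indicator_fibres:
  fixes h :: "'b \<Rightarrow> real"
  assumes "finite (range F)"
  shows "(\<Sum>y\<in>range F. h y * indicator (F -` {y}) x) = h (F x)"
proof -
  have "(\<Sum>y\<in>range F. h y * indicator (F -` {y}) x) = (\<Sum>y\<in>range F. if y = F x then h y else 0)"
    by (rule sum.cong) (auto simp: indicator_def)
  then show ?thesis using assms by simp
qed

text \<open>Each Jordan part integrates a simple function to a sum of \<open>upper_variation\<close>
  values; \<open>jordan_decomposition\<close> recombines the two sums into
  \<open>bval\<close>.\<close>

lemma baire_integral_simple:
  fixes F :: "'a::topological_space \<Rightarrow> 'b" and h :: "'b \<Rightarrow> real"
  assumes fin: "finite (range F)" and meas: "\<And>y. F -` {y} \<in> sets baire"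
  shows "baire_integral \<mu> (\<lambda>x. h (F x)) = (\<Sum>y\<in>range F. h y * bval \<mu> (F -` {y}))"
proof -
  have pos: "integral\<^sup>L (pos_part \<nu>) (\<lambda>x. h (F x)) = (\<Sum>y\<in>range F. h y * upper_variation \<nu> (F -` {y}))"
    for \<nu> :: "'a baire_measure"
  proof -
    interpret finite_measure "pos_part \<nu>" by (rule finite_measure_pos_part)
    have "(\<lambda>x. h (F x)) = (\<lambda>x. \<Sum>y\<in>range F. h y * indicator (F -` {y}) x)"
      by (simp add: sum_indicator_fibres[OF fin])
    then have "integral\<^sup>L (pos_part \<nu>) (\<lambda>x. h (F x)) =
        (\<Sum>y\<in>range F. integral\<^sup>L (pos_part \<nu>) (\<lambda>x. h y * indicator (F -` {y}) x))"
      using meas by (simp add: Bochner_Integration.integral_sum less_top[symmetric])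
    also have "\<dots> = (\<Sum>y\<in>range F. h y * upper_variation \<nu> (F -` {y}))"
      using meas by (simp add: measure_def emeasure_pos_part upper_variation_nonneg)
    finally show ?thesis .
  qed
  show ?thesis
    unfolding baire_integral_def pos sum_subtractf[symmetric]
    by (intro sum.cong refl) (simp add: jordan_decomposition[OF meas] algebra_simps)
qed

text \<open>Bounded convergence of \<open>f\<close> composed with \<open>F n\<close> towards
  \<open>f\<close>. Linearity in the measure and the norm bound are read off from these sums,
  because \<open>pos_part\<close> is not additive in the measure.\<close>

lemma baire_integral_approx:
  fixes f :: "'a::polish_space \<Rightarrow>\<^sub>C real"
  assumes F: "\<And>n. finite (range (F n))" "\<And>n y. F n -` {y} \<in> sets baire" "\<And>x. (\<lambda>n. F n x) \<longlonglongrightarrow> x"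
  shows "(\<lambda>n. \<Sum>y\<in>range (F n). apply_bcontfun f y * bval \<mu> (F n -` {y}))
    \<longlonglongrightarrow> baire_integral \<mu> (apply_bcontfun f)"
proof -
  have "(\<lambda>n. baire_integral \<mu> (\<lambda>x. apply_bcontfun f (F n x))) \<longlonglongrightarrow> baire_integral \<mu> (apply_bcontfun f)"
  proof (rule baire_integral_dominated_convergence[where B = "norm f"])
    show "apply_bcontfun f \<in> borel_measurable baire" by (rule continuous_measurable_baire) simp
    \<comment> \<open>\<open>F n\<close> has finite range, so every preimage is a finite union of
      fibres.\<close>
    show "(\<lambda>x. apply_bcontfun f (F n x)) \<in> borel_measurable baire" for n
    proof (rule measurableI)
      fix A :: "real set"
      have "(\<lambda>x. apply_bcontfun f (F n x)) -` A \<inter> space baire =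
          (\<Union>y\<in>{y\<in>range (F n). apply_bcontfun f y \<in> A}. F n -` {y})"
        by auto
      also have "\<dots> \<in> sets baire" using F(1,2) by (intro sets.finite_UN) auto
      finally show "(\<lambda>x. apply_bcontfun f (F n x)) -` A \<inter> space baire \<in> sets baire" .
    qed simp
    show "(\<lambda>n. apply_bcontfun f (F n x)) \<longlonglongrightarrow> apply_bcontfun f x" for x
      by (rule continuous_on_tendsto_compose[OF continuous_on_apply_bcontfun[of UNIV] F(3)]) auto
  qed (rule abs_bcontfun_le_norm)
  then show ?thesis by (simp add: baire_integral_simple F)
qed

lemma sum_abs_bval_fibres_le_norm:
  fixes \<mu> :: "'a::topological_space baire_measure"
  assumes "finite (range F)" "\<And>y. F -` {y} \<in> sets baire"
  shows "(\<Sum>y\<in>range F. \<bar>bval \<mu> (F -` {y})\<bar>) \<le> norm \<mu>"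
proof -
  \<comment> \<open>Fibres over points of the range are nonempty and disjoint, so distinct values
    index distinct cells of the partition.\<close>
  have inj: "inj_on (\<lambda>y. F -` {y}) (range F)" by (rule inj_onI) blast
  have "(\<lambda>y. F -` {y}) ` range F \<in> baire_partitions"
    using assms by (auto simp: baire_partitions_def partition_on_def disjoint_def)
  from variation_le_norm[OF this, of \<mu>] show ?thesis by (simp add: sum.reindex[OF inj])
qed

lemma abs_baire_integral_le:
  fixes f :: "'a::polish_space \<Rightarrow>\<^sub>C real"
  shows "\<bar>baire_integral \<mu> (apply_bcontfun f)\<bar> \<le> norm \<mu> * norm f"
proof -
  obtain F :: "nat \<Rightarrow> 'a \<Rightarrow> 'a"
    where F: "\<And>n. finite (range (F n))" "\<And>n y. F n -` {y} \<in> sets baire"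
      "\<And>x. (\<lambda>n. F n x) \<longlonglongrightarrow> x"
    using baire_simple_approx_ident by blast
  have "\<bar>\<Sum>y\<in>range (F n). apply_bcontfun f y * bval \<mu> (F n -` {y})\<bar> \<le> norm \<mu> * norm f"
    for n
  proof -
    have "\<bar>\<Sum>y\<in>range (F n). apply_bcontfun f y * bval \<mu> (F n -` {y})\<bar>
        \<le> (\<Sum>y\<in>range (F n). norm f * \<bar>bval \<mu> (F n -` {y})\<bar>)"
      by (rule order_trans[OF sum_abs sum_mono]) (simp add: abs_mult mult_right_mono abs_bcontfun_le_norm)
    also have "\<dots> \<le> norm f * norm \<mu>"
      unfolding sum_distrib_left[symmetric]
      by (intro mult_left_mono sum_abs_bval_fibres_le_norm F) simp
    finally show ?thesis by (simp add: mult.commute)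
  qed
  then show ?thesis
    using LIMSEQ_le_const2[OF tendsto_rabs[OF baire_integral_approx[OF F, of f \<mu>]]] by blast
qed

lemma linear_baire_integral_measure:
  fixes f :: "'a::polish_space \<Rightarrow>\<^sub>C real"
  shows "linear (\<lambda>\<mu>. baire_integral \<mu> (apply_bcontfun f))"
proof -
  obtain F :: "nat \<Rightarrow> 'a \<Rightarrow> 'a"
    where F: "\<And>n. finite (range (F n))" "\<And>n y. F n -` {y} \<in> sets baire"
      "\<And>x. (\<lambda>n. F n x) \<longlonglongrightarrow> x"
    using baire_simple_approx_ident by blast
  note lim = baire_integral_approx[OF F, of f]
  show ?thesis
  proof (rule linearI)
    fix \<mu> \<nu> :: "'a baire_measure" and c :: real
    show "baire_integral (\<mu> + \<nu>) (apply_bcontfun f) =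
        baire_integral \<mu> (apply_bcontfun f) + baire_integral \<nu> (apply_bcontfun f)"
      using LIMSEQ_unique[OF lim[of "\<mu> + \<nu>"]] tendsto_add[OF lim[of \<mu>] lim[of \<nu>]]
      by (simp add: sum.distrib algebra_simps)
    show "baire_integral (c *\<^sub>R \<mu>) (apply_bcontfun f) = c *\<^sub>R baire_integral \<mu> (apply_bcontfun f)"
      using LIMSEQ_unique[OF lim[of "c *\<^sub>R \<mu>"]] tendsto_mult_left[OF lim[of \<mu>], of c]
      by (simp add: sum_distrib_left algebra_simps)
  qed
qed

lemmas baire_integral_zero = linear_0[OF linear_baire_integral_measure]
lemmas baire_integral_diff = linear_diff[OF linear_baire_integral_measure]

lemma linear_baire_integral_fun:
  "linear (\<lambda>f :: 'a::topological_space \<Rightarrow>\<^sub>C real. baire_integral \<mu> (apply_bcontfun f))"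
  by (rule bounded_linear.linear[OF bounded_linear_baire_integral])

section \<open>Dirac measures and weak approximation by their finite combinations\<close>

lift_definition dirac :: "'a::topological_space \<Rightarrow> 'a baire_measure"
  is "\<lambda>x A. if A \<in> sets baire then indicator A x else 0"
proof (intro CollectI conjI allI impI)
  fix x :: 'a and A :: "nat \<Rightarrow> 'a set"
  assume A: "range A \<subseteq> sets baire \<and> disjoint_family A"
  then have "(\<lambda>i. indicator (A i) x :: real) sums indicator (\<Union>i. A i) x"
  proof (cases "x \<in> (\<Union>i. A i)")
    case True
    then obtain i where i: "x \<in> A i" by blast
    have "x \<notin> A j" if "j \<noteq> i" for j
      using A i that by (auto simp: disjoint_family_on_def)
    then have "(\<lambda>j. indicator (A j) x :: real) = (\<lambda>j. if j = i then 1 else 0)"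
      using i by (auto simp: indicator_def)
    moreover have "(\<lambda>j. if j = i then 1 else 0 :: real) sums 1" by (rule sums_single)
    ultimately show ?thesis using True by simp
  qed (simp add: indicator_def)
  moreover have "A i \<in> sets baire" "(\<Union>i. A i) \<in> sets baire" for i using A by auto
  ultimately show "(\<lambda>i. if A i \<in> sets baire then indicator (A i) x else 0 :: real) sums
      (if (\<Union>i. A i) \<in> sets baire then indicator (\<Union>i. A i) x else 0)" by simp
qed (auto simp: bounded_iff indicator_def intro!: exI[of _ 1])

lemma bval_dirac: "A \<in> sets baire \<Longrightarrow> bval (dirac x) A = indicator A x"
  by transfer simp

text \<open>Only the fibre through \<open>x\<close> has mass, so the \<open>n\<close>-th
  approximating sum is exactly the value of \<open>f\<close> at \<open>F n x\<close>.\<close>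

lemma baire_integral_dirac [simp]:
  fixes f :: "'a::polish_space \<Rightarrow>\<^sub>C real"
  shows "baire_integral (dirac x) (apply_bcontfun f) = apply_bcontfun f x"
proof -
  obtain F :: "nat \<Rightarrow> 'a \<Rightarrow> 'a"
    where F: "\<And>n. finite (range (F n))" "\<And>n y. F n -` {y} \<in> sets baire"
      "\<And>x. (\<lambda>n. F n x) \<longlonglongrightarrow> x"
    using baire_simple_approx_ident by blast
  have "(\<Sum>y\<in>range (F n). apply_bcontfun f y * bval (dirac x) (F n -` {y})) = apply_bcontfun f (F n x)" for n
    by (simp only: bval_dirac[OF F(2)] sum_indicator_fibres[OF F(1)])
  moreover have "(\<lambda>n. apply_bcontfun f (F n x)) \<longlonglongrightarrow> apply_bcontfun f x"
    by (rule continuous_on_tendsto_compose[OF continuous_on_apply_bcontfun[of UNIV] F(3)]) auto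
  ultimately show ?thesis
    using LIMSEQ_unique[OF baire_integral_approx[OF F, of f "dirac x"]] by simp
qed

lemma norm_dirac_le: "norm (dirac x) \<le> 1"
proof (rule norm_baire_measure_le)
  fix P :: "'a set set" assume "P \<in> baire_partitions"
  then have P: "finite P" "P \<subseteq> sets baire" "disjoint P" "\<Union>P = UNIV"
    by (auto simp: baire_partitions_def partition_on_def)
  have "(\<Sum>A\<in>P. \<bar>bval (dirac x) A\<bar>) = (\<Sum>A\<in>P. bval (dirac x) A)"
    using P(2) by (intro sum.cong) (auto simp: bval_dirac)
  also have "\<dots> = bval (dirac x) (\<Union>P)" by (rule bval_Union[symmetric]) fact+
  also have "\<dots> = 1" by (simp add: P bval_dirac)
  finally show "(\<Sum>A\<in>P. \<bar>bval (dirac x) A\<bar>) \<le> 1" by simp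
qed

text \<open>The approximants are the images of the measure under simple functions converging pointwise to
  the identity.\<close>
lemma dirac_combination_approx:
  fixes \<mu> :: "'a::polish_space baire_measure"
  obtains Y :: "nat \<Rightarrow> 'a set" and c :: "nat \<Rightarrow> 'a \<Rightarrow> real"
  where "\<And>n. norm (\<Sum>y\<in>Y n. c n y *\<^sub>R dirac y) \<le> norm \<mu>"
    "\<And>f. (\<lambda>n. \<Sum>y\<in>Y n. c n y * apply_bcontfun f y) \<longlonglongrightarrow> baire_integral \<mu> (apply_bcontfun f)"
proof -
  obtain F :: "nat \<Rightarrow> 'a \<Rightarrow> 'a"
    where F: "\<And>n. finite (range (F n))" "\<And>n y. F n -` {y} \<in> sets baire"
      "\<And>x. (\<lambda>n. F n x) \<longlonglongrightarrow> x"
    using baire_simple_approx_ident by blast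
  show ?thesis
  proof
    show "norm (\<Sum>y\<in>range (F n). bval \<mu> (F n -` {y}) *\<^sub>R dirac y) \<le> norm \<mu>" for n
    proof -
      have "norm (\<Sum>y\<in>range (F n). bval \<mu> (F n -` {y}) *\<^sub>R dirac y)
          \<le> (\<Sum>y\<in>range (F n). \<bar>bval \<mu> (F n -` {y})\<bar>)"
        by (rule sum_norm_le) (simp add: mult_left_le norm_dirac_le)
      then show ?thesis using sum_abs_bval_fibres_le_norm[OF F(1,2), of \<mu> n] by simp
    qed
    show "(\<lambda>n. \<Sum>y\<in>range (F n). bval \<mu> (F n -` {y}) * apply_bcontfun f y)
        \<longlonglongrightarrow> baire_integral \<mu> (apply_bcontfun f)" for f
      using baire_integral_approx[OF F, of f \<mu>] by (simp add: mult.commute)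
  qed
qed

section \<open>A gliding hump lemma\<close>

text \<open>Baire category, to be applied to the coefficient sequences
  \<open>nat \<Rightarrow> real\<close> with the product topology.\<close>

lemma Baire_closed_cover:
  fixes E :: "nat \<Rightarrow> 'a::complete_space set"
  assumes "\<And>n. closed (E n)" "(\<Union>n. E n) = UNIV"
  obtains n where "interior (E n) \<noteq> {}"
proof (rule ccontr)
  assume "\<not> thesis"
  then have *: "interior (E n) = {}" for n using that by blast
  have "euclidean interior_of \<Union>(range E) = {}"
    by (rule Baire_category_alt)
      (use * assms in \<open>auto simp: completely_metrizable_space_euclidean closed_closedin[symmetric]\<close>)
  then show False using assms(2) by (simp add: interior_of_topspace[of euclidean, simplified])
qed

lemma LIMSEQ_fun_iff:
  fixes X :: "nat \<Rightarrow> 'i \<Rightarrow> 'b::topological_space"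
  shows "X \<longlonglongrightarrow> l \<longleftrightarrow> (\<forall>i. (\<lambda>n. X n i) \<longlonglongrightarrow> l i)"
  using limitin_componentwise[of "\<lambda>_. euclidean" UNIV X l sequentially]
  by (simp add: euclidean_product_topology)

lemma apply_Bcontfun:
  fixes f :: "'a::topological_space \<Rightarrow> real"
  assumes "continuous_on UNIV f" "\<And>x. \<bar>f x\<bar> \<le> b"
  shows "apply_bcontfun (Bcontfun f) = f"
  using assms by (intro Bcontfun_inverse bcontfun_normI[of _ b]) auto

text \<open>A superposition of the functions \<open>a k\<close> that stays bounded by 1, no matter how many of
  them overlap, provided that each of them is.\<close>
primrec hump_sum :: "(nat \<Rightarrow> 'a \<Rightarrow> real) \<Rightarrow> nat \<Rightarrow> 'a \<Rightarrow> real" where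
  "hump_sum a 0 x = 0"
| "hump_sum a (Suc k) x = (1 - \<bar>a k x\<bar>) * hump_sum a k x + a k x"

text \<open>Each step forms a convex combination of the previous value and the sign of
  \<open>a k x\<close>, with weights \<open>1 - \<bar>a k x\<bar>\<close> and
  \<open>\<bar>a k x\<bar>\<close>.\<close>

lemma abs_hump_sum_le_1:
  assumes "\<And>k. \<bar>a k x\<bar> \<le> 1"
  shows "\<bar>hump_sum a k x\<bar> \<le> 1"
proof (induction k)
  case (Suc k)
  have "\<bar>hump_sum a (Suc k) x\<bar> \<le> \<bar>(1 - \<bar>a k x\<bar>) * hump_sum a k x\<bar> + \<bar>a k x\<bar>"
    by simp
  also have "\<bar>(1 - \<bar>a k x\<bar>) * hump_sum a k x\<bar> \<le> (1 - \<bar>a k x\<bar>) * 1"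
    unfolding abs_mult using Suc assms[of k] by (intro mult_mono) auto
  finally show ?case by simp
qed simp

lemma hump_sum_cong:
  "(\<And>j. j < k \<Longrightarrow> a j x = b j x) \<Longrightarrow> hump_sum a k x = hump_sum b k x"
  by (induction k) auto

lemma hump_sum_stable:
  assumes "\<And>j. j \<ge> N \<Longrightarrow> a j x = 0" "k \<ge> N"
  shows "hump_sum a k x = hump_sum a N x"
  using assms(2) by (induction rule: dec_induct) (auto simp: assms(1))

lemma continuous_on_hump_sum:
  "(\<And>j. continuous_on A (a j)) \<Longrightarrow> continuous_on A (hump_sum a k)"
  by (induction k) (auto intro!: continuous_intros simp: fun_eq_iff cong: continuous_on_cong)

text \<open>Local finiteness allows the humps to be superposed with any coefficient sequence
  \<open>s\<close>, giving a bounded continuous function that depends continuously on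
  \<open>s\<close>. Baire category makes the convergence in \<open>null\<close> uniform over an open
  set of coefficients. Such a set restricts only finitely many coordinates, so a late coefficient
  can be varied freely, and this isolates a single hump.\<close>

lemma gliding_hump_locally_finite:
  fixes \<phi> :: "nat \<Rightarrow> ('a::topological_space \<Rightarrow>\<^sub>C real) \<Rightarrow> real"
  assumes lin: "\<And>n. linear (\<phi> n)"
    and dom: "\<And>n f g B. (\<And>k::nat. norm (f k) \<le> B) \<Longrightarrow>
      (\<And>x. (\<lambda>k. apply_bcontfun (f k) x) \<longlonglongrightarrow> apply_bcontfun g x) \<Longrightarrow> (\<lambda>k. \<phi> n (f k)) \<longlonglongrightarrow> \<phi> n g"
    and null: "\<And>f. (\<lambda>n. \<phi> n f) \<longlonglongrightarrow> 0"
    and h1: "\<And>n. norm (h n) \<le> 1"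
    and lf: "\<And>x. \<exists>U N. open U \<and> x \<in> U \<and> (\<forall>n\<ge>N. \<forall>y\<in>U. apply_bcontfun (h n) y = 0)"
  shows "(\<lambda>n. \<phi> n (h n)) \<longlonglongrightarrow> 0"
proof (rule LIMSEQ_I)
  fix e :: real assume e: "e > 0"
  \<comment> \<open>Clipping the coefficients lets \<open>s\<close> range over the whole space
    \<open>nat \<Rightarrow> real\<close>, to which Baire category applies, while every hump stays
    bounded by 1.\<close>
  define a where "a s k x = max (-1) (min 1 (s k)) * apply_bcontfun (h k) x" for s :: "nat \<Rightarrow> real" and k x
  have a1: "\<bar>a s k x\<bar> \<le> 1" for s k x
    using mult_mono[of "\<bar>max (-1) (min 1 (s k))\<bar>" 1 "\<bar>apply_bcontfun (h k) x\<bar>" 1]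
      abs_bcontfun_le_norm[of "h k" x] h1[of k] by (auto simp: a_def abs_mult)
  \<comment> \<open>By local finiteness the partial superpositions are eventually constant at each
    point, so this limit is a finite stage.\<close>
  define g where "g s x = lim (\<lambda>k. hump_sum (a s) k x)" for s x
  have g_eq: "g s x = hump_sum (a s) N x" if "\<And>j. j \<ge> N \<Longrightarrow> apply_bcontfun (h j) x = 0" for s x N
    unfolding g_def
  proof (rule limI, rule tendsto_eventually, rule eventually_sequentiallyI[of N])
    show "hump_sum (a s) k x = hump_sum (a s) N x" if "N \<le> k" for k
      using that by (intro hump_sum_stable) (auto simp: a_def \<open>\<And>j. j \<ge> N \<Longrightarrow> _ j = _\<close>)
  qed
  have g1: "\<bar>g s x\<bar> \<le> 1" for s x
  proof -
    obtain U N where "x \<in> U" "\<forall>n\<ge>N. \<forall>y\<in>U. apply_bcontfun (h n) y = 0" using lf by blast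
    then have "g s x = hump_sum (a s) N x" by (intro g_eq) auto
    then show ?thesis using abs_hump_sum_le_1[of "a s" x N] a1 by auto
  qed
  \<comment> \<open>Near every point \<open>g s\<close> coincides with one finite
    \<open>hump_sum\<close>; continuity is then glued over the open cover \<open>W\<close>.\<close>
  have g_cont: "continuous_on UNIV (g s)" for s
  proof -
    have "\<exists>U. open U \<and> x \<in> U \<and> continuous_on U (g s)" for x
    proof -
      obtain U N where U: "open U" "x \<in> U" "\<forall>n\<ge>N. \<forall>y\<in>U. apply_bcontfun (h n) y = 0" using lf by blast
      have "continuous_on UNIV (a s k)" for k
        unfolding a_def by (intro continuous_intros continuous_on_apply_bcontfun)
      then have "continuous_on U (hump_sum (a s) N)"
        using continuous_on_hump_sum continuous_on_subset by blast
      then have "continuous_on U (g s)"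
        by (rule continuous_on_eq) (metis U(3) g_eq)
      then show ?thesis using U by blast
    qed
    moreover define W where "W = {U. open U \<and> continuous_on U (g s)}"
    ultimately have W: "\<Union>W = UNIV" by blast
    have "continuous_on (\<Union>W) (g s)"
      by (rule continuous_on_open_Union) (simp_all add: W_def)
    then show ?thesis by (simp add: W)
  qed
  define G where "G s = Bcontfun (g s)" for s
  have G: "apply_bcontfun (G s) = g s" for s
    unfolding G_def by (rule apply_Bcontfun[OF g_cont g1])
  have normG: "norm (G s) \<le> 1" for s
    by (rule norm_bound) (simp add: G g1)
  \<comment> \<open>At a fixed point only finitely many coefficients matter, so coordinatewise
    convergence of \<open>X\<close> gives pointwise convergence, and \<open>dom\<close> applies with
    the bound 1.\<close>
  have G_lim: "(\<lambda>j. \<phi> n (G (X j))) \<longlonglongrightarrow> \<phi> n (G s)" if "X \<longlonglongrightarrow> s" for n X s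
  proof (rule dom[OF normG])
    fix x
    obtain U N where U: "x \<in> U" "\<forall>n\<ge>N. \<forall>y\<in>U. apply_bcontfun (h n) y = 0" using lf by blast
    have X: "(\<lambda>j. X j k) \<longlonglongrightarrow> s k" for k using that by (simp add: LIMSEQ_fun_iff)
    have "(\<lambda>j. hump_sum (a (X j)) k x) \<longlonglongrightarrow> hump_sum (a s) k x" for k
      by (induction k) (auto simp: a_def intro!: tendsto_intros X)
    moreover have "g t x = hump_sum (a t) N x" for t using U by (intro g_eq) auto
    ultimately show "(\<lambda>j. apply_bcontfun (G (X j)) x) \<longlonglongrightarrow> apply_bcontfun (G s) x"
      by (simp add: G)
  qed
  \<comment> \<open>Baire category in the space of coefficient sequences \<open>s\<close>: on some open set of coefficients
    the bound \<open>\<bar>\<phi> n (G s)\<bar> \<le> e / 2\<close> is uniform from some \<open>n = M\<close> on.\<close>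
  define E where "E M = {s. \<forall>n\<ge>M. \<bar>\<phi> n (G s)\<bar> \<le> e / 2}" for M :: nat
  have "closed (E M)" for M
    unfolding closed_sequential_limits
  proof safe
    fix X s assume X: "\<forall>n. X n \<in> E M" and lim: "X \<longlonglongrightarrow> s"
    have "\<bar>\<phi> n (G s)\<bar> \<le> e / 2" if "n \<ge> M" for n
      by (rule LIMSEQ_le_const2[OF tendsto_rabs[OF G_lim[OF lim, of n]]])
        (use X that in \<open>auto simp: E_def\<close>)
    then show "s \<in> E M" by (simp add: E_def)
  qed
  moreover have "(\<Union>M. E M) = UNIV"
  proof -
    have "\<exists>M. s \<in> E M" for s
      using LIMSEQ_D[OF null[of "G s"], of "e / 2"] e unfolding E_def by (fastforce intro: less_imp_le)
    then show ?thesis by blast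
  qed
  ultimately obtain M where "interior (E M) \<noteq> {}" using Baire_closed_cover by blast
  then obtain s where s: "s \<in> interior (E M)" by blast
  \<comment> \<open>\<open>G (X 1 n) - G (X (-1) n)\<close> is \<open>2 h n\<close>, because \<open>h n\<close> is the last hump with a nonzero coefficient.\<close>
  define X where "X c n k = (if k < n then s k else if k = n then c else 0)" for c :: real and n k :: nat
  have "\<forall>\<^sub>F n in sequentially. X c n \<in> E M" for c
  \<comment> \<open>\<open>X c n\<close> differs from \<open>s\<close> only at indices
    \<open>\<ge> n\<close>, so every fixed coordinate is eventually that of \<open>s\<close>,
    whatever \<open>c\<close> is.\<close>
  proof -
    have "X c \<longlonglongrightarrow> s"
      unfolding LIMSEQ_fun_iff
    proof
      show "(\<lambda>n. X c n i) \<longlonglongrightarrow> s i" for i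
        by (rule tendsto_eventually, rule eventually_sequentiallyI[of "Suc i"]) (simp add: X_def)
    qed
    then have "\<forall>\<^sub>F n in sequentially. X c n \<in> interior (E M)"
      using s by (rule topological_tendstoD[OF _ open_interior])
    then show ?thesis by (rule eventually_mono) (use interior_subset in blast)
  qed
  then have "\<forall>\<^sub>F n in sequentially. X 1 n \<in> E M \<and> X (-1) n \<in> E M \<and> n \<ge> M"
    by (intro eventually_conj eventually_ge_at_top)
  then have "\<forall>\<^sub>F n in sequentially. norm (\<phi> n (h n) - 0) < e"
  proof (rule eventually_mono)
    fix n assume n: "X 1 n \<in> E M \<and> X (-1) n \<in> E M \<and> n \<ge> M"
    have "apply_bcontfun (G (X 1 n)) x - apply_bcontfun (G (X (-1) n)) x = 2 * apply_bcontfun (h n) x" for x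
    proof -
      obtain U N where U: "x \<in> U" "\<forall>n\<ge>N. \<forall>y\<in>U. apply_bcontfun (h n) y = 0" using lf by blast
      have *: "g (X c n) x = hump_sum (a (X c n)) (Suc n) x" for c
      proof -
        \<comment> \<open>This stage lies beyond both the last hump active at \<open>x\<close> and
          the last coefficient that can be nonzero.\<close>
        have "g (X c n) x = hump_sum (a (X c n)) (max N (Suc n)) x"
          using U by (intro g_eq) auto
        also have "\<dots> = hump_sum (a (X c n)) (Suc n) x"
          by (rule hump_sum_stable) (auto simp: a_def X_def)
        finally show ?thesis .
      qed
      \<comment> \<open>The damping factor of step \<open>n\<close> sees only the absolute value of
        the coefficient, so it is the same for 1 and -1; the damped earlier part cancels in the
        difference.\<close>
      have "hump_sum (a (X 1 n)) n x = hump_sum (a (X (-1) n)) n x"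
        by (rule hump_sum_cong) (simp add: a_def X_def)
      then show ?thesis by (simp add: G *) (simp add: a_def X_def)
    qed
    then have "G (X 1 n) - G (X (-1) n) = 2 *\<^sub>R h n"
      by (intro bcontfun_eqI) simp
    then have "2 * \<phi> n (h n) = \<phi> n (G (X 1 n)) - \<phi> n (G (X (-1) n))"
      by (metis linear_cmul[OF lin] linear_diff[OF lin] real_scaleR_def)
    moreover have "\<bar>\<phi> n (G (X 1 n))\<bar> \<le> e / 2" "\<bar>\<phi> n (G (X (-1) n))\<bar> \<le> e / 2"
      using n by (auto simp: E_def)
    ultimately show "norm (\<phi> n (h n) - 0) < e" using e by simp
  qed
  then show "\<exists>N. \<forall>n\<ge>N. norm (\<phi> n (h n) - 0) < e" by (simp add: eventually_sequentially)
qed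

text \<open>Truncation at height \<open>d\<close> splits \<open>f n\<close> into \<open>g n\<close>,
  uniformly small and controlled by \<open>bnd\<close>, and an excess that vanishes wherever
  \<open>f n\<close> is below \<open>d\<close> in absolute value. By \<open>f_small\<close> the
  excesses are locally finite.\<close>

lemma gliding_hump:
  fixes \<phi> :: "nat \<Rightarrow> ('a::topological_space \<Rightarrow>\<^sub>C real) \<Rightarrow> real"
  assumes lin: "\<And>n. linear (\<phi> n)"
    and dom: "\<And>n f g B. (\<And>k::nat. norm (f k) \<le> B) \<Longrightarrow>
      (\<And>x. (\<lambda>k. apply_bcontfun (f k) x) \<longlonglongrightarrow> apply_bcontfun g x) \<Longrightarrow> (\<lambda>k. \<phi> n (f k)) \<longlonglongrightarrow> \<phi> n g"
    and null: "\<And>f. (\<lambda>n. \<phi> n f) \<longlonglongrightarrow> 0"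
    and bnd: "\<And>n f. \<bar>\<phi> n f\<bar> \<le> C * norm f"
    and f_bnd: "\<And>n. norm (f n) \<le> B"
    and f_small: "\<And>x e. e > 0 \<Longrightarrow> \<exists>U N. open U \<and> x \<in> U \<and> (\<forall>n\<ge>N. \<forall>y\<in>U. \<bar>apply_bcontfun (f n) y\<bar> < e)"
  shows "(\<lambda>n. \<phi> n (f n)) \<longlonglongrightarrow> 0"
proof (rule LIMSEQ_I)
  fix e :: real assume e: "e > 0"
  \<comment> \<open>Chosen so that the truncated part contributes at most
    \<open>\<bar>C\<bar> * d \<le> e / 2\<close>; adding 1 here and in \<open>b\<close> keeps both
    divisors positive.\<close>
  define d where "d = e / (2 * (\<bar>C\<bar> + 1))"
  have d: "d > 0" using e by (simp add: d_def add_nonneg_pos)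
  define b where "b = \<bar>B\<bar> + 1"
  have b: "b > 0" by (simp add: b_def add_nonneg_pos)
  define g where "g n = Bcontfun (\<lambda>x. max (-d) (min d (apply_bcontfun (f n) x)))" for n
  have g: "apply_bcontfun (g n) x = max (-d) (min d (apply_bcontfun (f n) x))" for n x
    unfolding g_def using d by (subst apply_Bcontfun[of _ d]) (auto intro!: continuous_intros)
  define h where "h n = (1 / b) *\<^sub>R (f n - g n)" for n
  have "(\<lambda>n. \<phi> n (h n)) \<longlonglongrightarrow> 0"
  proof (rule gliding_hump_locally_finite[OF lin dom null])
    fix n
    have "norm (f n - g n) \<le> b"
    proof (rule norm_bound)
      fix x
      have "\<bar>apply_bcontfun (f n) x\<bar> \<le> b"
        using abs_bcontfun_le_norm[of "f n" x] f_bnd[of n] by (simp add: b_def)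
      then show "norm (apply_bcontfun (f n - g n) x) \<le> b" using d by (auto simp: g)
    qed
    then show "norm (h n) \<le> 1" using b by (simp add: h_def)
  next
    fix x
    obtain U N where "open U" "x \<in> U" "\<forall>n\<ge>N. \<forall>y\<in>U. \<bar>apply_bcontfun (f n) y\<bar> < d"
      using f_small[OF d] by blast
    then show "\<exists>U N. open U \<and> x \<in> U \<and> (\<forall>n\<ge>N. \<forall>y\<in>U. apply_bcontfun (h n) y = 0)"
      by (intro exI[of _ U] exI[of _ N]) (fastforce simp: h_def g)
  qed
  then obtain N where N: "\<And>n. n \<ge> N \<Longrightarrow> \<bar>\<phi> n (h n)\<bar> < e / (2 * b)"
    using LIMSEQ_D[of "\<lambda>n. \<phi> n (h n)" 0 "e / (2 * b)"] e b by auto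
  have "norm (\<phi> n (f n) - 0) < e" if "n \<ge> N" for n
  proof -
    have "f n = b *\<^sub>R h n + g n" using b by (simp add: h_def)
    then have "\<phi> n (f n) = b * \<phi> n (h n) + \<phi> n (g n)"
      by (metis linear_add[OF lin] linear_cmul[OF lin] real_scaleR_def)
    moreover have "\<bar>b * \<phi> n (h n)\<bar> < e / 2" using N[OF that] b by (simp add: abs_mult field_simps)
    moreover have "\<bar>\<phi> n (g n)\<bar> \<le> e / 2"
    proof -
      have "norm (g n) \<le> d" using d by (intro norm_bound) (auto simp: g)
      then have "C * norm (g n) \<le> \<bar>C\<bar> * d" by (intro mult_mono) auto
      then have "\<bar>\<phi> n (g n)\<bar> \<le> \<bar>C\<bar> * d" using bnd[of n "g n"] by linarith
      also have "\<dots> \<le> (\<bar>C\<bar> + 1) * d" using d by simp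
      also have "\<dots> = e / 2" unfolding d_def by (simp add: field_simps)
      finally show ?thesis .
    qed
    ultimately show ?thesis by simp
  qed
  then show "\<exists>N. \<forall>n\<ge>N. norm (\<phi> n (f n) - 0) < e" by blast
qed

section \<open>Seminorm topologies\<close>

lemma openin_seminorm_ball:
  "p \<in> P \<Longrightarrow> e > 0 \<Longrightarrow> openin (seminorm_topology P) {x. p (x - x0) < e}"
  unfolding seminorm_topology_def by (rule topology_generated_by_Basis) blast

text \<open>Transfers seminorm estimates to neighbourhoods, uniformly over an index set
  \<open>A\<close>: a time interval for equicontinuity, a singleton for plain convergence. Induction
  over the generated topology reduces this to subbasic balls.\<close>

lemma eventually_seminorm_topology:
  fixes y :: "'i \<Rightarrow> 't \<Rightarrow> 'x::real_vector"
  assumes sub: "\<And>p x y. p \<in> P \<Longrightarrow> p (x + y) \<le> p x + p y"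
    and ev: "\<And>p e. p \<in> P \<Longrightarrow> e > 0 \<Longrightarrow> \<forall>\<^sub>F n in F. \<forall>t\<in>A. p (y n t - l) < e"
    and "openin (seminorm_topology P) U" "l \<in> U"
  shows "\<forall>\<^sub>F n in F. \<forall>t\<in>A. y n t \<in> U"
proof -
  have "generate_topology_on {{x. p (x - x0) < e} |p x0 e. p \<in> P \<and> e > 0} U"
    using assms(3) unfolding seminorm_topology_def by (rule openin_topology_generated_by)
  then show ?thesis using \<open>l \<in> U\<close>
  proof induction
    case (Int U V)
    then have "\<forall>\<^sub>F n in F. (\<forall>t\<in>A. y n t \<in> U) \<and> (\<forall>t\<in>A. y n t \<in> V)"
      by (intro eventually_conj) auto
    then show ?case by (rule eventually_mono) blast
  next
    case (UN \<U>)
    then obtain U where U: "U \<in> \<U>" "\<forall>\<^sub>F n in F. \<forall>t\<in>A. y n t \<in> U" by blast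
    show ?case by (rule eventually_mono[OF U(2)]) (use U(1) in blast)
  next
    case (Basis V)
    then obtain p x0 e where p: "p \<in> P" and V: "V = {x. p (x - x0) < e}" by blast
    have "p (l - x0) < e" using Basis V by simp
    \<comment> \<open>The ball may be centred at \<open>x0\<close> rather than \<open>l\<close>; its
      remaining radius at \<open>l\<close> is the tolerance used.\<close>
    then have "\<forall>\<^sub>F n in F. \<forall>t\<in>A. p (y n t - l) < e - p (l - x0)" by (intro ev p) simp
    then show ?case
    proof (rule eventually_mono)
      fix n assume n: "\<forall>t\<in>A. p (y n t - l) < e - p (l - x0)"
      show "\<forall>t\<in>A. y n t \<in> V"
      proof
        fix t assume "t \<in> A"
        then have "p (y n t - l) + p (l - x0) < e" using n by fastforce
        then show "y n t \<in> V"
          using sub[OF p, of "y n t - l" "l - x0"] by (simp add: V)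
      qed
    qed
  qed simp
qed

lemma continuous_map_seminorm_topology:
  assumes "P \<noteq> {}" "\<And>p x0. p \<in> P \<Longrightarrow> continuous_on A (\<lambda>t. p (g t - x0))"
  shows "continuous_map (top_of_set A) (seminorm_topology P) g"
  unfolding seminorm_topology_def
proof (rule continuous_on_generated_topo)
  fix U assume "U \<in> {{x. p (x - x0) < e} |p x0 e. p \<in> P \<and> e > 0}"
  then obtain p x0 e where U: "p \<in> P" "U = {x. p (x - x0) < e}" by blast
  have "openin (top_of_set A) (A \<inter> (\<lambda>t. p (g t - x0)) -` {..<e})"
    by (rule continuous_openin_preimage_gen[OF assms(2)]) (use U in auto)
  moreover have "A \<inter> (\<lambda>t. p (g t - x0)) -` {..<e} = g -` U \<inter> topspace (top_of_set A)"
    using U by auto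
  ultimately show "openin (top_of_set A) (g -` U \<inter> topspace (top_of_set A))" by simp
next
  obtain p where p: "p \<in> P" using assms(1) by blast
  show "g ` topspace (top_of_set A) \<subseteq> \<Union>{{x. p (x - x0) < e} |p x0 e. p \<in> P \<and> e > 0}"
  proof (intro subsetI UnionI)
    fix x
    \<comment> \<open>The radius exceeds \<open>p (x - x)\<close>, so this subbasic set contains
      \<open>x\<close>; the subbasis covers the whole space.\<close>
    show "{z. p (z - x) < \<bar>p 0\<bar> + 1} \<in> {{x. p (x - x0) < e} |p x0 e. p \<in> P \<and> e > 0}"
      using p by (intro CollectI exI[of _ p] exI[of _ x] exI[of _ "\<bar>p 0\<bar> + 1"]) auto
    show "x \<in> {z. p (z - x) < \<bar>p 0\<bar> + 1}" by simp
  qed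
qed

lemma continuous_map_seminorm_topologyD:
  assumes "continuous_map (top_of_set A) (seminorm_topology P) g" "p \<in> P" "p 0 = 0" "t \<in> A" "e > 0"
  obtains d where "d > 0" "\<And>s. s \<in> A \<Longrightarrow> dist s t < d \<Longrightarrow> p (g s - g t) < e"
proof -
  have "openin (top_of_set A) {s \<in> topspace (top_of_set A). g s \<in> {x. p (x - g t) < e}}"
    by (rule openin_continuous_map_preimage[OF assms(1) openin_seminorm_ball]) fact+
  then show ?thesis
    using that assms(3-5) by (fastforce simp: openin_euclidean_subtopology_iff)
qed

section \<open>Compact-open seminorms and null sequences in the two topologies\<close>

lemma bdd_above_abs_bcontfun:
  fixes f :: "'a::topological_space \<Rightarrow>\<^sub>C real"
  shows "bdd_above ((\<lambda>x. \<bar>apply_bcontfun f x\<bar>) ` K)"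
  by (rule bdd_aboveI2[of _ _ "norm f"]) (rule abs_bcontfun_le_norm)

lemma abs_bcontfun_le_SUP:
  fixes f :: "'a::topological_space \<Rightarrow>\<^sub>C real"
  shows "x \<in> K \<Longrightarrow> \<bar>apply_bcontfun f x\<bar> \<le> (SUP x\<in>K. \<bar>apply_bcontfun f x\<bar>)"
  by (rule cSUP_upper[OF _ bdd_above_abs_bcontfun])

lemma SUP_abs_bcontfun_add_le:
  fixes f g :: "'a::topological_space \<Rightarrow>\<^sub>C real"
  assumes "K \<noteq> {}"
  shows "(SUP x\<in>K. \<bar>apply_bcontfun (f + g) x\<bar>)
    \<le> (SUP x\<in>K. \<bar>apply_bcontfun f x\<bar>) + (SUP x\<in>K. \<bar>apply_bcontfun g x\<bar>)"
proof (rule cSUP_least[OF assms])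
  fix x assume "x \<in> K"
  then show "\<bar>apply_bcontfun (f + g) x\<bar>
      \<le> (SUP x\<in>K. \<bar>apply_bcontfun f x\<bar>) + (SUP x\<in>K. \<bar>apply_bcontfun g x\<bar>)"
    using abs_bcontfun_le_SUP[of x K f] abs_bcontfun_le_SUP[of x K g] by simp
qed

lemma limitin_weak_measure_topology_zeroI:
  fixes X :: "nat \<Rightarrow> 'a::polish_space baire_measure"
  assumes "\<And>f. (\<lambda>n. baire_integral (X n) (apply_bcontfun f)) \<longlonglongrightarrow> 0"
  shows "limitin weak_measure_topology X 0 sequentially"
  unfolding limitin_def
proof (intro conjI allI impI)
  let ?P = "{\<lambda>\<mu>. \<bar>blinfun_apply (measure_functional \<mu>) f\<bar> | f :: 'a \<Rightarrow>\<^sub>C real. True}"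
  \<comment> \<open>\<open>limitin\<close> also demands that the limit lie in
    \<open>topspace\<close>; the ball of the seminorm of the zero function shows this.\<close>
  have "openin weak_measure_topology {\<mu> :: 'a baire_measure. \<bar>blinfun_apply (measure_functional (\<mu> - 0)) 0\<bar> < 1}"
    unfolding weak_measure_topology_def
    by (rule openin_seminorm_ball[where p = "\<lambda>\<mu>. \<bar>blinfun_apply (measure_functional \<mu>) 0\<bar>"], blast) simp
  from openin_subset[OF this] show "(0 :: 'a baire_measure) \<in> topspace weak_measure_topology"
    by (auto simp: baire_integral_zero)
  fix U :: "'a baire_measure set" assume U: "openin weak_measure_topology U \<and> 0 \<in> U"
  have "\<forall>\<^sub>F n in sequentially. \<forall>t\<in>{()}. X n \<in> U"
  proof (rule eventually_seminorm_topology)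
    show "openin (seminorm_topology ?P) U" "0 \<in> U"
      using U by (simp_all add: weak_measure_topology_def)
    show "p (x + y) \<le> p x + p y" if "p \<in> ?P" for p and x y :: "'a baire_measure"
      using that by (auto simp: linear_add[OF linear_baire_integral_measure] abs_triangle_ineq)
    show "\<forall>\<^sub>F n in sequentially. \<forall>t\<in>{()}. p (X n - 0) < e" if "p \<in> ?P" "e > 0" for p e
      using that assms by (auto simp: tendsto_iff dist_real_def)
  qed
  then show "\<forall>\<^sub>F n in sequentially. X n \<in> U" by simp
qed

text \<open>If smallness failed near \<open>x\<close>, there would be points \<open>y N\<close>
  tending to \<open>x\<close> with large values of functions of index at least \<open>N\<close>.
  These points together with \<open>x\<close> form a compact set, on which convergence is
  uniform.\<close>

lemma limitin_compact_open_topology_locally_small: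
  fixes f :: "nat \<Rightarrow> 'a::metric_space \<Rightarrow>\<^sub>C real"
  assumes lim: "limitin compact_open_topology f 0 sequentially" and e: "e > 0"
  shows "\<exists>U N. open U \<and> x \<in> U \<and> (\<forall>n\<ge>N. \<forall>y\<in>U. \<bar>apply_bcontfun (f n) y\<bar> < e)"
proof (rule ccontr)
  assume neg: "\<not> ?thesis"
  have "\<exists>n y. n \<ge> N \<and> y \<in> ball x (inverse (real (Suc N))) \<and> \<bar>apply_bcontfun (f n) y\<bar> \<ge> e" for N
  proof (rule ccontr)
    assume "\<nexists>n y. n \<ge> N \<and> y \<in> ball x (inverse (real (Suc N))) \<and> \<bar>apply_bcontfun (f n) y\<bar> \<ge> e"
    then have "open (ball x (inverse (real (Suc N)))) \<and> x \<in> ball x (inverse (real (Suc N))) \<and>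
        (\<forall>n\<ge>N. \<forall>y\<in>ball x (inverse (real (Suc N))). \<bar>apply_bcontfun (f n) y\<bar> < e)"
      by (metis centre_in_ball inverse_positive_iff_positive not_le of_nat_0_less_iff open_ball zero_less_Suc)
    then show False using neg by blast
  qed
  then obtain n y where n: "\<And>N. n N \<ge> N" and y: "\<And>N. y N \<in> ball x (inverse (real (Suc N)))"
    and ge: "\<And>N. \<bar>apply_bcontfun (f (n N)) (y N)\<bar> \<ge> e" by metis
  have "y \<longlonglongrightarrow> x"
  proof (rule metric_tendsto_imp_tendsto[OF LIMSEQ_inverse_real_of_nat])
    show "\<forall>\<^sub>F N in sequentially. dist (y N) x \<le> dist (inverse (real (Suc N))) 0"
      using y by (intro always_eventually) (auto simp: dist_commute intro: less_imp_le simp del: of_nat_Suc)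
  qed
  define K where "K = insert x (range y)"
  have K: "compact K" 
    using compactin_sequence_with_limit[of euclidean y x "range y"] \<open>y \<longlonglongrightarrow> x\<close>
    by (simp add: K_def)
  define p where "p = (\<lambda>g :: 'a \<Rightarrow>\<^sub>C real. SUP x\<in>K. \<bar>apply_bcontfun g x\<bar>)"
  have "openin compact_open_topology {g. p (g - 0) < e}"
    unfolding compact_open_topology_def
    by (rule openin_seminorm_ball) (use e K in \<open>unfold p_def K_def, blast+\<close>)
  moreover have "K \<noteq> {}" by (simp add: K_def)
  then have "p 0 = 0" by (simp add: p_def)
  ultimately have "\<forall>\<^sub>F n in sequentially. f n \<in> {g. p (g - 0) < e}"
    using lim e unfolding limitin_def by fastforce
  then obtain N where N: "\<And>n. n \<ge> N \<Longrightarrow> p (f n) < e" by (auto simp: eventually_sequentially)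
  have "\<bar>apply_bcontfun (f (n N)) (y N)\<bar> \<le> p (f (n N))"
    unfolding p_def by (rule abs_bcontfun_le_SUP) (simp add: K_def)
  then show False using N[OF n[of N]] ge[of N] by linarith
qed

section \<open>The preadjoint semigroup\<close>

locale weak_bi_continuous_semigroup =
  fixes S :: "real \<Rightarrow> 'a::polish_space baire_measure \<Rightarrow>\<^sub>L 'a baire_measure"
  assumes bi_cont: "bi_continuous_semigroup weak_measure_topology S"
begin

section \<open>Weak continuity and local norm bounds of the given semigroup\<close>

lemma S_0: "S 0 = id_blinfun"
  and S_add: "\<lbrakk>t \<ge> 0; s \<ge> 0\<rbrakk> \<Longrightarrow> S (t + s) = S t o\<^sub>L S s"
  using bi_cont by (simp_all add: bi_continuous_semigroup_def)

lemma continuous_on_S: "continuous_on {0..} (\<lambda>t. baire_integral (S t \<mu>) (apply_bcontfun f))"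
  unfolding continuous_on_iff
proof (intro ballI allI impI)
  fix t e :: real assume t: "t \<in> {0..}" and e: "e > 0"
  let ?P = "{\<lambda>\<mu>. \<bar>blinfun_apply (measure_functional \<mu>) f\<bar> | f :: 'a \<Rightarrow>\<^sub>C real. True}"
  have "continuous_map (top_of_set {0..}) (seminorm_topology ?P) (\<lambda>t. S t \<mu>)"
    using bi_cont by (simp add: bi_continuous_semigroup_def weak_measure_topology_def)
  then obtain d where "d > 0"
    "\<And>s. s \<in> {0..} \<Longrightarrow> dist s t < d \<Longrightarrow> \<bar>blinfun_apply (measure_functional (S s \<mu> - S t \<mu>)) f\<bar> < e"
    by (rule continuous_map_seminorm_topologyD[of _ _ _ "\<lambda>\<mu>. \<bar>blinfun_apply (measure_functional \<mu>) f\<bar>" t e])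
      (use t e in \<open>auto simp: baire_integral_zero\<close>)
  then show "\<exists>d>0. \<forall>s\<in>{0..}. dist s t < d \<longrightarrow>
      dist (baire_integral (S s \<mu>) (apply_bcontfun f)) (baire_integral (S t \<mu>) (apply_bcontfun f)) < e"
    by (auto simp: dist_real_def baire_integral_diff)
qed

text \<open>Sequential equicontinuity of \<open>S\<close>, tested against a single function.\<close>

lemma S_null:
  assumes "\<And>n. norm (\<mu> n) \<le> C" "\<And>f. (\<lambda>n. baire_integral (\<mu> n) (apply_bcontfun f)) \<longlonglongrightarrow> 0"
    and "0 \<le> a" "a \<le> b" "e > 0"
  shows "\<forall>\<^sub>F n in sequentially. \<forall>t\<in>{a..b}. \<bar>baire_integral (S t (\<mu> n)) (apply_bcontfun f)\<bar> < e"
proof -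
  have "bounded (range \<mu>)" using assms(1) by (auto simp: bounded_iff)
  moreover have "limitin weak_measure_topology \<mu> 0 sequentially"
    by (rule limitin_weak_measure_topology_zeroI) fact
  moreover have "openin weak_measure_topology {\<mu>. \<bar>blinfun_apply (measure_functional (\<mu> - 0)) f\<bar> < e}"
    unfolding weak_measure_topology_def
    by (rule openin_seminorm_ball[where p = "\<lambda>\<mu>. \<bar>blinfun_apply (measure_functional \<mu>) f\<bar>"])
      (use assms in auto)
  moreover have "0 \<in> {\<mu>. \<bar>blinfun_apply (measure_functional (\<mu> - 0)) f\<bar> < e}"
    using \<open>e > 0\<close> by (simp add: baire_integral_zero)
  ultimately have "\<forall>\<^sub>F n in sequentially. \<forall>t\<in>{a..b}.
      S t (\<mu> n) \<in> {\<mu>. \<bar>blinfun_apply (measure_functional (\<mu> - 0)) f\<bar> < e}"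
    using bi_cont assms(3,4) unfolding bi_continuous_semigroup_def by blast
  then show ?thesis by simp
qed

text \<open>The bound on the unit interval propagates in unit steps through
  \<open>S t = S (t - 1) o\<^sub>L S 1\<close>.\<close>

lemma norm_S_bounded_nat: "\<exists>C. \<forall>t\<in>{0..real n}. norm (S t) \<le> C"
proof (induction n)
  case 0
  then show ?case by auto
next
  case (Suc n)
  then obtain C where C: "\<And>t. t \<in> {0..real n} \<Longrightarrow> norm (S t) \<le> C" by blast
  have "bounded (S ` {0..1})" using bi_cont by (simp add: bi_continuous_semigroup_def)
  then obtain D where D: "\<And>t. t \<in> {0..1} \<Longrightarrow> norm (S t) \<le> D" unfolding bounded_iff by blast
  have "C \<ge> 0" using C[of 0] norm_ge_zero[of "S 0"] by (simp del: norm_ge_zero)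
  have "norm (S t) \<le> max D (C * D)" if t: "t \<in> {0..real (Suc n)}" for t
  proof (cases "t \<le> 1")
    case True
    then show ?thesis using D[of t] t by simp
  next
    case False
    have "norm (S ((t - 1) + 1)) \<le> norm (S (t - 1)) * norm (S 1)"
      using False S_add[of "t - 1" 1] norm_blinfun_compose by simp
    also have "\<dots> \<le> C * D"
      using False t \<open>C \<ge> 0\<close> by (intro mult_mono C D) auto
    finally show ?thesis by simp
  qed
  then show ?case by blast
qed

lemma norm_S_bounded:
  obtains C where "C \<ge> 0" "\<And>t. t \<in> {0..b} \<Longrightarrow> norm (S t) \<le> C"
proof -
  obtain n where n: "b \<le> real n" using real_arch_simple by blast
  obtain C where C: "\<And>t. t \<in> {0..real n} \<Longrightarrow> norm (S t) \<le> C"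
    using norm_S_bounded_nat[of n] by blast
  show ?thesis
  proof
    show "max 0 C \<ge> 0" by simp
    show "norm (S t) \<le> max 0 C" if "t \<in> {0..b}" for t
      using C[of t] that n by auto
  qed
qed

text \<open>Split \<open>dirac (x n)\<close> into \<open>dirac (x n) - dirac x0\<close> and
  \<open>dirac x0\<close>. The first part is a bounded weak null sequence, handled by
  \<open>S_null\<close> uniformly over the times in \<open>{0..b}\<close>; the second is continuity
  of one orbit.\<close>

lemma S_dirac_convergence:
  assumes t: "\<And>n. t n \<ge> 0" "t \<longlonglongrightarrow> t0" and x: "x \<longlonglongrightarrow> x0"
  shows "(\<lambda>n. baire_integral (S (t n) (dirac (x n))) (apply_bcontfun f))
    \<longlonglongrightarrow> baire_integral (S t0 (dirac x0)) (apply_bcontfun f)"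
proof -
  have t0: "t0 \<ge> 0" by (rule LIMSEQ_le_const[OF t(2)]) (use t(1) in auto)
  obtain b where b: "\<And>n. t n \<le> b"
    using convergent_imp_Bseq[of t] t(2) by (auto simp: convergent_def Bseq_def intro: order_trans[OF abs_ge_self])
  have "b \<ge> 0" using t(1) b order_trans by blast
  have "(\<lambda>n. baire_integral (S (t n) (dirac (x n) - dirac x0)) (apply_bcontfun f)) \<longlonglongrightarrow> 0"
  proof (rule tendstoI)
    fix e :: real assume "e > 0"
    have "\<forall>\<^sub>F n in sequentially. \<forall>s\<in>{0..b}. \<bar>baire_integral (S s (dirac (x n) - dirac x0)) (apply_bcontfun f)\<bar> < e"
    proof (rule S_null)
      show "norm (dirac (x n) - dirac x0) \<le> 2" for n
        using norm_triangle_ineq4[of "dirac (x n)" "dirac x0"] norm_dirac_le[of "x n"] norm_dirac_le[of x0]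
        by linarith
      show "(\<lambda>n. baire_integral (dirac (x n) - dirac x0) (apply_bcontfun g)) \<longlonglongrightarrow> 0" for g
        unfolding baire_integral_diff baire_integral_dirac
        by (rule LIM_zero, rule continuous_on_tendsto_compose[OF continuous_on_apply_bcontfun[of UNIV] x]) auto
    qed (use \<open>b \<ge> 0\<close> \<open>e > 0\<close> in auto)
    then show "\<forall>\<^sub>F n in sequentially.
        dist (baire_integral (S (t n) (dirac (x n) - dirac x0)) (apply_bcontfun f)) 0 < e"
      by (rule eventually_mono) (use t(1) b in \<open>auto simp: dist_real_def\<close>)
  qed
  moreover have "(\<lambda>n. baire_integral (S (t n) (dirac x0)) (apply_bcontfun f))
      \<longlonglongrightarrow> baire_integral (S t0 (dirac x0)) (apply_bcontfun f)"
    by (rule continuous_on_tendsto_compose[OF continuous_on_S t(2)]) (use t t0 in auto)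
  ultimately have "(\<lambda>n. baire_integral (S (t n) (dirac (x n) - dirac x0)) (apply_bcontfun f)
      + baire_integral (S (t n) (dirac x0)) (apply_bcontfun f))
      \<longlonglongrightarrow> 0 + baire_integral (S t0 (dirac x0)) (apply_bcontfun f)"
    by (rule tendsto_add)
  then show ?thesis by (simp add: blinfun.diff_right baire_integral_diff)
qed

section \<open>The preadjoint operators, obtained by testing the adjoint relation on Dirac
  measures\<close>

definition predual :: "real \<Rightarrow> ('a \<Rightarrow>\<^sub>C real) \<Rightarrow>\<^sub>L ('a \<Rightarrow>\<^sub>C real)" where
  "predual t = Blinfun (\<lambda>f. Bcontfun (\<lambda>x. baire_integral (S t (dirac x)) (apply_bcontfun f)))"

lemma continuous_on_S_dirac:
  "continuous_on ({0..} \<times> UNIV) (\<lambda>(t, x). baire_integral (S t (dirac x)) (apply_bcontfun f))"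
  unfolding continuous_on_sequentially
proof (intro allI ballI impI)
  fix z :: "nat \<Rightarrow> real \<times> 'a" and z0 :: "real \<times> 'a"
  assume "z0 \<in> {0..} \<times> UNIV" and "(\<forall>n. z n \<in> {0..} \<times> UNIV) \<and> z \<longlonglongrightarrow> z0"
  then show "((\<lambda>(t, x). baire_integral (S t (dirac x)) (apply_bcontfun f)) \<circ> z) \<longlonglongrightarrow>
      (case z0 of (t, x) \<Rightarrow> baire_integral (S t (dirac x)) (apply_bcontfun f))"
    unfolding o_def case_prod_beta
    by (intro S_dirac_convergence tendsto_fst tendsto_snd) (auto simp: mem_Times_iff)
qed

lemma abs_S_dirac_le:
  "\<bar>baire_integral (S t (dirac x)) (apply_bcontfun f)\<bar> \<le> norm (S t) * norm f"
proof (rule order_trans[OF abs_baire_integral_le], rule mult_right_mono)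
  show "norm (S t (dirac x)) \<le> norm (S t)"
    using norm_blinfun[of "S t" "dirac x"] mult_left_le[OF norm_dirac_le[of x] norm_ge_zero[of "S t"]]
    by linarith
qed simp

text \<open>For \<open>t \<ge> 0\<close> the inner function is bounded and continuous and the outer
  map bounded and linear, so \<open>Bcontfun\<close> and \<open>Blinfun\<close> in
  \<open>predual\<close> return the intended objects.\<close>

lemma
  assumes t: "t \<ge> 0"
  shows predual_apply: "apply_bcontfun (predual t f) x = baire_integral (S t (dirac x)) (apply_bcontfun f)"
    and norm_predual_le: "norm (predual t) \<le> norm (S t)"
proof -
  define T where "T f = Bcontfun (\<lambda>x. baire_integral (S t (dirac x)) (apply_bcontfun f))" for f :: "'a \<Rightarrow>\<^sub>C real"
  have T: "apply_bcontfun (T f) x = baire_integral (S t (dirac x)) (apply_bcontfun f)" for f x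
  proof -
    have "continuous_on UNIV (\<lambda>x. baire_integral (S t (dirac x)) (apply_bcontfun f))"
      using continuous_on_compose2[OF continuous_on_S_dirac[of f]
          continuous_on_Pair[OF continuous_on_const continuous_on_id], of t UNIV] t
      by auto
    then show ?thesis
      unfolding T_def by (subst apply_Bcontfun[OF _ abs_S_dirac_le]) auto
  qed
  have le: "norm (T f) \<le> norm (S t) * norm f" for f
    by (rule norm_bound) (simp add: T abs_S_dirac_le)
  have "bounded_linear T"
  proof (rule bounded_linear_intro[where K = "norm (S t)"])
    show "T (f + g) = T f + T g" for f g
      by (rule bcontfun_eqI) (simp add: T linear_add[OF linear_baire_integral_fun, simplified])
    show "T (c *\<^sub>R f) = c *\<^sub>R T f" for c f
      by (rule bcontfun_eqI) (simp add: T linear_cmul[OF linear_baire_integral_fun, simplified])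
    show "norm (T f) \<le> norm f * norm (S t)" for f using le[of f] by (simp add: mult.commute)
  qed
  then have *: "blinfun_apply (predual t) = T"
    unfolding predual_def T_def[abs_def] by (rule bounded_linear_Blinfun_apply)
  show "apply_bcontfun (predual t f) x = baire_integral (S t (dirac x)) (apply_bcontfun f)"
    by (simp add: * T)
  show "norm (predual t) \<le> norm (S t)"
    by (rule norm_blinfun_bound) (simp_all add: * le)
qed

text \<open>True for Dirac measures by construction and for finite combinations by linearity. A
  bounded sequence of combinations tends weakly to the measure: the left side converges because
  \<open>predual t f\<close> is again a test function, the right side by
  \<open>S_null\<close>.\<close>

lemma baire_integral_predual:
  assumes t: "t \<ge> 0"
  shows "baire_integral \<mu> (apply_bcontfun (predual t f)) = baire_integral (S t \<mu>) (apply_bcontfun f)"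
proof -
  obtain Y :: "nat \<Rightarrow> 'a set" and c :: "nat \<Rightarrow> 'a \<Rightarrow> real"
    where bound: "\<And>n. norm (\<Sum>y\<in>Y n. c n y *\<^sub>R dirac y) \<le> norm \<mu>"
      and lim: "\<And>f. (\<lambda>n. \<Sum>y\<in>Y n. c n y * apply_bcontfun f y) \<longlonglongrightarrow> baire_integral \<mu> (apply_bcontfun f)"
    by (rule dirac_combination_approx[of \<mu>]) (rule that)
  define \<nu> where "\<nu> n = (\<Sum>y\<in>Y n. c n y *\<^sub>R dirac y)" for n
  have int: "baire_integral (\<Sum>y\<in>Y n. c n y *\<^sub>R \<rho> y) (apply_bcontfun g) =
      (\<Sum>y\<in>Y n. c n y * baire_integral (\<rho> y) (apply_bcontfun g))"
    for n g and \<rho> :: "'a \<Rightarrow> 'a baire_measure"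
    by (simp add: linear_sum[OF linear_baire_integral_measure] linear_cmul[OF linear_baire_integral_measure])
  \<comment> \<open>A degenerate time interval: only the single operator \<open>S t\<close> is
    involved.\<close>
  have "\<forall>\<^sub>F n in sequentially. \<forall>s\<in>{t..t}. \<bar>baire_integral (S s (\<nu> n - \<mu>)) (apply_bcontfun f)\<bar> < e"
    if "e > 0" for e
  proof (rule S_null)
    show "norm (\<nu> n - \<mu>) \<le> 2 * norm \<mu>" for n
      using norm_triangle_ineq4[of "\<nu> n" \<mu>] bound[of n] by (simp add: \<nu>_def)
    show "(\<lambda>n. baire_integral (\<nu> n - \<mu>) (apply_bcontfun g)) \<longlonglongrightarrow> 0" for g
      using LIM_zero[OF lim[of g]] by (simp add: baire_integral_diff \<nu>_def int)
  qed (use t that in auto)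
  then have "(\<lambda>n. baire_integral (S t (\<nu> n - \<mu>)) (apply_bcontfun f)) \<longlonglongrightarrow> 0"
    by (simp add: tendsto_iff dist_real_def)
  then have "(\<lambda>n. baire_integral (S t (\<nu> n)) (apply_bcontfun f)) \<longlonglongrightarrow> baire_integral (S t \<mu>) (apply_bcontfun f)"
    by (simp add: blinfun.diff_right baire_integral_diff LIM_zero_iff)
  moreover have "baire_integral (S t (\<nu> n)) (apply_bcontfun f) =
      (\<Sum>y\<in>Y n. c n y * apply_bcontfun (predual t f) y)" for n
    by (simp add: \<nu>_def blinfun.sum_right blinfun.scaleR_right int predual_apply[OF t])
  ultimately show ?thesis using LIMSEQ_unique[OF lim[of "predual t f"]] by simp
qed

section \<open>Semigroup law, orbit continuity and equicontinuity of the preadjoint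
  operators\<close>

lemma predual_0: "predual 0 = id_blinfun"
  by (intro blinfun_eqI bcontfun_eqI) (simp add: predual_apply S_0)

lemma predual_add:
  assumes "t \<ge> 0" "s \<ge> 0"
  shows "predual (t + s) = predual t o\<^sub>L predual s"
proof (intro blinfun_eqI bcontfun_eqI)
  fix f x
  \<comment> \<open>Passing to the preadjoint reverses composition, so the sum is expanded as
    \<open>s + t\<close>.\<close>
  have "apply_bcontfun (predual (t + s) f) x = baire_integral (S s (S t (dirac x))) (apply_bcontfun f)"
    using assms S_add[of s t] by (simp add: predual_apply add.commute)
  also have "\<dots> = apply_bcontfun (predual t (predual s f)) x"
    using assms by (simp add: predual_apply baire_integral_predual)
  finally show "apply_bcontfun (predual (t + s) f) x = apply_bcontfun ((predual t o\<^sub>L predual s) f) x"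
    by simp
qed

text \<open>Joint continuity in time and point is uniform on a compact product; the supremum over
  \<open>K\<close> varies no more than the values do.\<close>

lemma continuous_on_predual:
  assumes K: "compact K" "K \<noteq> {}"
  shows "continuous_on {0..} (\<lambda>t. SUP x\<in>K. \<bar>apply_bcontfun (predual t f - g) x\<bar>)"
  unfolding continuous_on_iff
proof (intro ballI allI impI)
  fix t e :: real assume t: "t \<in> {0..}" and e: "e > 0"
  let ?q = "\<lambda>h. SUP x\<in>K. \<bar>apply_bcontfun h x\<bar>"
  \<comment> \<open>The interval extends to \<open>t + 1\<close> so that it contains all times
    within distance 1 of \<open>t\<close> on both sides.\<close>
  have "uniformly_continuous_on ({0..t + 1} \<times> K) (\<lambda>(t, x). baire_integral (S t (dirac x)) (apply_bcontfun f))"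
    by (intro compact_uniformly_continuous compact_Times K compact_Icc
        continuous_on_subset[OF continuous_on_S_dirac]) auto
  then obtain d where d: "d > 0" 
    and unif: "\<And>z z'. z \<in> {0..t + 1} \<times> K \<Longrightarrow> z' \<in> {0..t + 1} \<times> K \<Longrightarrow> dist z' z < d \<Longrightarrow>
      dist (case z' of (t, x) \<Rightarrow> baire_integral (S t (dirac x)) (apply_bcontfun f))
        (case z of (t, x) \<Rightarrow> baire_integral (S t (dirac x)) (apply_bcontfun f)) < e / 2"
    unfolding uniformly_continuous_on_def using e by (metis half_gt_zero)
  have "dist (?q (predual s f - g)) (?q (predual t f - g)) < e" if s: "s \<in> {0..}" "dist s t < min d 1" for s
  proof -
    have le: "?q (predual s f - predual t f) \<le> e / 2" "?q (predual t f - predual s f) \<le> e / 2"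
    proof -
      have *: "\<bar>apply_bcontfun (predual s f) x - apply_bcontfun (predual t f) x\<bar> \<le> e / 2" if x: "x \<in> K" for x
      proof -
        have "s \<le> t + 1" using s(2) by (auto simp: dist_real_def abs_less_iff)
        then show ?thesis
          using unif[of "(t, x)" "(s, x)"] s t x
          by (simp add: dist_Pair_Pair predual_apply dist_real_def)
      qed
      show "?q (predual s f - predual t f) \<le> e / 2" "?q (predual t f - predual s f) \<le> e / 2"
        by (rule cSUP_least[OF K(2)], use * in \<open>simp add: abs_minus_commute\<close>)+
    qed
    show ?thesis
      using SUP_abs_bcontfun_add_le[OF K(2), of "predual s f - predual t f" "predual t f - g"]
        SUP_abs_bcontfun_add_le[OF K(2), of "predual t f - predual s f" "predual s f - g"] le e
      by (simp add: dist_real_def)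
  qed
  then show "\<exists>d>0. \<forall>s\<in>{0..}. dist s t < d \<longrightarrow> dist (?q (predual s f - g)) (?q (predual t f - g)) < e"
    using d by (intro exI[of _ "min d 1"]) auto
qed

text \<open>By compactness of time interval and \<open>K\<close>, a failure yields convergent times
  and points. The limit functional sends the functions to 0 by dominated convergence; the
  differences from it form a weak null sequence, to which \<open>gliding_hump\<close>
  applies.\<close>

lemma predual_equicontinuous:
  fixes f :: "nat \<Rightarrow> 'a \<Rightarrow>\<^sub>C real"
  assumes f: "\<And>n. norm (f n) \<le> B" "limitin compact_open_topology f 0 sequentially"
    and K: "compact K" "K \<noteq> {}" and a: "0 \<le> a" and e: "e > 0"
  shows "\<forall>\<^sub>F n in sequentially. \<forall>t\<in>{a..b}. (SUP x\<in>K. \<bar>apply_bcontfun (predual t (f n)) x\<bar>) < e"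
proof (rule ccontr)
  assume neg: "\<not> ?thesis"
  \<comment> \<open>Halving the threshold turns a supremum that is not below \<open>e\<close> into a
    large value at an actual point of \<open>K\<close>.\<close>
  have "\<exists>n t x. n \<ge> N \<and> t \<in> {a..b} \<and> x \<in> K \<and> \<bar>apply_bcontfun (predual t (f n)) x\<bar> > e / 2" for N
  proof -
    obtain n t where n: "n \<ge> N" "t \<in> {a..b}" and ge: "\<not> (SUP x\<in>K. \<bar>apply_bcontfun (predual t (f n)) x\<bar>) < e"
      using neg unfolding eventually_sequentially by blast
    have "\<exists>x\<in>K. \<bar>apply_bcontfun (predual t (f n)) x\<bar> > e / 2"
    proof (rule ccontr)
      assume "\<not> ?thesis"
      then have "(SUP x\<in>K. \<bar>apply_bcontfun (predual t (f n)) x\<bar>) \<le> e / 2"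
        by (intro cSUP_least K) (auto simp: not_less)
      then show False using ge e by simp
    qed
    then show ?thesis using n by blast
  qed
  then obtain n t x where n: "\<And>N. n N \<ge> N" and t: "\<And>N. t N \<in> {a..b}" and x: "\<And>N. x N \<in> K"
    and gt: "\<And>N. \<bar>apply_bcontfun (predual (t N) (f (n N))) (x N)\<bar> > e / 2" by metis
  have "seq_compact ({a..b} \<times> K)"
    by (intro compact_imp_seq_compact compact_Times K compact_Icc)
  moreover have "\<forall>N. (t N, x N) \<in> {a..b} \<times> K" using t x by blast
  ultimately obtain z r where z: "z \<in> {a..b} \<times> K" and r: "strict_mono (r :: nat \<Rightarrow> nat)"
    and lim: "((\<lambda>N. (t N, x N)) \<circ> r) \<longlonglongrightarrow> z" by (rule seq_compactE)
  obtain t0 x0 where z_eq: "z = (t0, x0)" by fastforce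
  have tr: "(\<lambda>k. t (r k)) \<longlonglongrightarrow> t0" and xr: "(\<lambda>k. x (r k)) \<longlonglongrightarrow> x0"
    using tendsto_fst[OF lim] tendsto_snd[OF lim] by (simp_all add: z_eq o_def)
  have t_nonneg: "t N \<ge> 0" for N using t[of N] a by simp
  \<comment> \<open>The selected functions have indices at least \<open>k\<close>, so
    \<open>h\<close> inherits local smallness with the same \<open>U\<close> and
    \<open>N\<close>.\<close>
  have nr: "n (r k) \<ge> k" for k using n[of "r k"] seq_suble[OF r, of k] by linarith
  define h where "h k = f (n (r k))" for k
  have h_small: "\<exists>U N. open U \<and> y \<in> U \<and> (\<forall>k\<ge>N. \<forall>y\<in>U. \<bar>apply_bcontfun (h k) y\<bar> < d)" if "d > 0" for y d
  proof -
    obtain U N where "open U" "y \<in> U" "\<forall>n\<ge>N. \<forall>y\<in>U. \<bar>apply_bcontfun (f n) y\<bar> < d"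
      using limitin_compact_open_topology_locally_small[OF f(2) \<open>d > 0\<close>] by blast
    moreover have "n (r k) \<ge> N" if "k \<ge> N" for k N using nr[of k] that by linarith
    ultimately show ?thesis unfolding h_def by (intro exI[of _ U] exI[of _ N]) simp
  qed
  obtain C where C: "C \<ge> 0" "\<And>s. s \<in> {0..b} \<Longrightarrow> norm (S s) \<le> C" using norm_S_bounded by blast
  define \<phi> where "\<phi> k g = baire_integral (S (t (r k)) (dirac (x (r k))) - S t0 (dirac x0)) (apply_bcontfun g)"
    for k and g :: "'a \<Rightarrow>\<^sub>C real"
  have "(\<lambda>k. \<phi> k (h k)) \<longlonglongrightarrow> 0"
  proof (rule gliding_hump)
    show "linear (\<phi> k)" for k unfolding \<phi>_def[abs_def] by (rule linear_baire_integral_fun)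
    show "(\<lambda>j. \<phi> k (u j)) \<longlonglongrightarrow> \<phi> k v" if "\<And>j. norm (u j) \<le> D"
      "\<And>y. (\<lambda>j. apply_bcontfun (u j) y) \<longlonglongrightarrow> apply_bcontfun v y" for k u v D
      unfolding \<phi>_def using that by (rule baire_integral_bcontfun_convergence)
    show "(\<lambda>k. \<phi> k g) \<longlonglongrightarrow> 0" for g
      unfolding \<phi>_def baire_integral_diff
      by (rule LIM_zero, rule S_dirac_convergence) (use t_nonneg tr xr in auto)
    show "\<bar>\<phi> k g\<bar> \<le> (2 * C) * norm g" for k g
    proof -
      have "\<bar>baire_integral (S s (dirac y)) (apply_bcontfun g)\<bar> \<le> C * norm g" if "s \<in> {0..b}" for s y
        by (rule order_trans[OF abs_S_dirac_le mult_right_mono]) (use C that in auto)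
      from this[of "t (r k)" "x (r k)"] this[of t0 x0] show ?thesis
        using t[of "r k"] a z by (simp add: \<phi>_def baire_integral_diff z_eq)
    qed
    show "norm (h k) \<le> B" for k by (simp add: h_def f)
  qed (rule h_small)
  moreover have "(\<lambda>k. baire_integral (S t0 (dirac x0)) (apply_bcontfun (h k)))
      \<longlonglongrightarrow> baire_integral (S t0 (dirac x0)) (apply_bcontfun 0)"
  proof (rule baire_integral_bcontfun_convergence)
    show "norm (h k) \<le> B" for k by (simp add: h_def f)
    show "(\<lambda>k. apply_bcontfun (h k) y) \<longlonglongrightarrow> apply_bcontfun 0 y" for y
    proof (rule LIMSEQ_I)
      fix d :: real assume "d > 0"
      then show "\<exists>N. \<forall>k\<ge>N. norm (apply_bcontfun (h k) y - apply_bcontfun 0 y) < d"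
        using h_small[of d y] by fastforce
    qed
  qed
  moreover have "baire_integral (S t0 (dirac x0)) (apply_bcontfun 0) = 0"
    using linear_0[OF linear_baire_integral_fun[of "S t0 (dirac x0)"]] by simp
  ultimately have "(\<lambda>k. \<phi> k (h k) + baire_integral (S t0 (dirac x0)) (apply_bcontfun (h k))) \<longlonglongrightarrow> 0 + 0"
    by (intro tendsto_add) simp_all
  moreover have "\<phi> k (h k) + baire_integral (S t0 (dirac x0)) (apply_bcontfun (h k)) =
      apply_bcontfun (predual (t (r k)) (h k)) (x (r k))" for k
    by (simp add: \<phi>_def baire_integral_diff predual_apply t_nonneg)
  ultimately have "(\<lambda>k. apply_bcontfun (predual (t (r k)) (h k)) (x (r k))) \<longlonglongrightarrow> 0" by simp
  then obtain k where "\<bar>apply_bcontfun (predual (t (r k)) (h k)) (x (r k))\<bar> < e / 2"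
    using LIMSEQ_D[of "\<lambda>k. apply_bcontfun (predual (t (r k)) (h k)) (x (r k))" 0 "e / 2"] e by auto
  then show False using gt[of "r k"] by (simp add: h_def)
qed

lemma bi_continuous_predual: "bi_continuous_semigroup compact_open_topology predual"
  unfolding bi_continuous_semigroup_def
proof (intro conjI allI impI)
  let ?P = "{\<lambda>f :: 'a \<Rightarrow>\<^sub>C real. SUP x\<in>K. \<bar>apply_bcontfun f x\<bar> | K. compact K \<and> K \<noteq> {}}"
  show "predual 0 = id_blinfun" by (rule predual_0)
  show "predual (t + s) = predual t o\<^sub>L predual s" if "t \<ge> 0" "s \<ge> 0" for t s
    using that by (rule predual_add)
  have P_nonempty: "?P \<noteq> {}" using compact_sing by blast
  show "continuous_map (top_of_set {0..}) compact_open_topology (\<lambda>t. predual t f)" for f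
    unfolding compact_open_topology_def
    by (rule continuous_map_seminorm_topology[OF P_nonempty]) (auto intro: continuous_on_predual)
  show "bounded (predual ` {0..1})"
  proof -
    obtain C where "C \<ge> 0" "\<And>t. t \<in> {0..1} \<Longrightarrow> norm (S t) \<le> C" using norm_S_bounded by blast
    then show ?thesis
      by (auto simp: bounded_iff intro!: exI[of _ C] order_trans[OF norm_predual_le])
  qed
  fix f :: "nat \<Rightarrow> 'a \<Rightarrow>\<^sub>C real" and a b :: real and U :: "('a \<Rightarrow>\<^sub>C real) set"
  assume f: "bounded (range f) \<and> limitin compact_open_topology f 0 sequentially"
    and ab: "0 \<le> a \<and> a \<le> b" and U: "openin compact_open_topology U \<and> 0 \<in> U"
  obtain B where B: "\<And>n. norm (f n) \<le> B" using f by (auto simp: bounded_iff)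
  show "\<forall>\<^sub>F n in sequentially. \<forall>t\<in>{a..b}. predual t (f n) \<in> U"
  proof (rule eventually_seminorm_topology)
    show "openin (seminorm_topology ?P) U" "0 \<in> U"
      using U by (simp_all add: compact_open_topology_def)
    show "p (g + h) \<le> p g + p h" if in_P: "p \<in> ?P" for p g h
    proof -
      obtain K where "K \<noteq> {}" and p_eq: "p = (\<lambda>f. SUP x\<in>K. \<bar>apply_bcontfun f x\<bar>)"
        using in_P by (elim CollectE exE conjE)
      then show ?thesis unfolding p_eq by (intro SUP_abs_bcontfun_add_le)
    qed
    show "\<forall>\<^sub>F n in sequentially. \<forall>t\<in>{a..b}. p (predual t (f n) - 0) < e"
      if in_P: "p \<in> ?P" and "e > 0" for p e
    proof -
      obtain K where K: "compact K" "K \<noteq> {}" and p_eq: "p = (\<lambda>f. SUP x\<in>K. \<bar>apply_bcontfun f x\<bar>)"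
        using in_P by (elim CollectE exE conjE)
      have "limitin compact_open_topology f 0 sequentially" "0 \<le> a" using f ab by auto
      from predual_equicontinuous[OF B this(1) K this(2) \<open>e > 0\<close>]
      show ?thesis unfolding p_eq diff_zero .
    qed
  qed
qed

end

theorem theorem3p6:
  fixes S :: "real \<Rightarrow> 'a::polish_space baire_measure \<Rightarrow>\<^sub>L 'a baire_measure"
  assumes "bi_continuous_semigroup weak_measure_topology S"
  shows "\<exists>T :: real \<Rightarrow> ('a \<Rightarrow>\<^sub>C real) \<Rightarrow>\<^sub>L ('a \<Rightarrow>\<^sub>C real).
           bi_continuous_semigroup compact_open_topology T \<and>
           (\<forall>t\<ge>0. \<forall>\<mu>. banach_adjoint (T t) (measure_functional \<mu>) = measure_functional (S t \<mu>))"
proof -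
  interpret weak_bi_continuous_semigroup S by standard (rule assms)
  \<comment> \<open>Evaluated at a test function, the two functionals are the two sides of
    \<open>baire_integral_predual\<close>.\<close>
  have "banach_adjoint (predual t) (measure_functional \<mu>) = measure_functional (S t \<mu>)" if "t \<ge> 0" for t \<mu>
    by (rule blinfun_eqI) (simp add: baire_integral_predual that)
  then show ?thesis using bi_continuous_predual by blast
qed

end
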